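(* Assume (A1), (A2), (A3) and (A4) (stated in the context), and let $q,\psi_0$ and the core sequence $\overline S_0,\overline S_1,\dots$ with levels $\overline\nu_0<\overline\nu_1<\dots$ be as in the context. Then for any set $\mathcal A\subset\mathbb Z^d_*:=\bigcup_{N\ge1}(\mathbb Z^d)^N$ and any integers $n\ge m\ge0$, $$\mathbf P_*\big(\alpha(n)<T_*,\ \eta_*(n)=m,\ (S_0,\dots,S_{\alpha(n)})\in\mathcal A\big)=\psi_0\,q^n\,\mathbf P\big(\overline\nu_m=n,\ (\overline S_0,\dots,\overline S_{\overline\alpha(n)})\in\mathcal A\big),$$ where $\overline\alpha(n)=\inf\{t\ge0:\overline S_t[1]\ge n\}$.
   Context: Conventions: $\inf\emptyset=\infty$, $\sup\emptyset=-\infty$. Fix $d\ge1$; $x[1]$ is the first coordinate of $x\in\mathbb Z^d$; $\mathbb Z^d_{0+}=\{x\in\mathbb Z^d: x[1]\ge0\}$. Model. $S_t=S_0+\sum_{j=1}^t\xi_j$, $t\ge0$, is a random walk on $\mathbb Z^d$; $H(x)\in\{0,1,2,\dots\}\cup\{\infty\}$, $x\in\mathbb Z^d$, are random constraints. $L_t(x)=\sum_{j=0}^t\mathbf 1\{S_j=x\}$; $T_*=\inf\{t\ge0: L_t(S_t)>H(S_t)\}\le\infty$; $\alpha(n)=\inf\{t\ge0:S_t[1]\ge n\}\le\infty$; $B_n=\{\alpha(n)<T_*\}$ for $n\ge0$. $\mathbf P_*$ denotes the probability in this model. (A1) $\xi_1,\xi_2,\dots$ are i.i.d. $\mathbb Z^d$-valued,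 $\mathbf P(\xi_1[1]\le1)=1$ and $\mathbf P(\xi_1[1]=1)>0$. (A2) The three families $\{S_0;\,H(x),x\notin\mathbb Z^d_{0+}\}$, $\{\xi_i,i\ge1\}$, $\{H(x),x\in\mathbb Z^d_{0+}\}$ are mutually independent, $S_0[1]\le0$ a.s., and $\mathbf P_*(B_0)>0$. (A3) $\{H(x),x\in\mathbb Z^d_{0+}\}$ are i.i.d. with $\mathbf P(1\le H(0)\le\infty)=1$. (A4) Let $\beta_0=\inf\{t>0:\xi_1[1]+\dots+\xi_t[1]=0\}$ and $\beta_{0,0}=\inf\{t>0:\xi_1+\dots+\xi_t=0\}$. If $\mathbf P(\beta_0<\infty)=1$ then $\mathbf P(\beta_{0,0}<\infty)>0$; and if $\mathbf P(\beta_0=\beta_{0,0}<\infty)=1$ then $\mathbf E H(0)<\infty$. $\mathbf P_0$ denotes the probability in the same model (same laws of $\{\xi_i\}$ and of $\{H(x),x\in\mathbb Z^d_{0+}\}$) but with $S_0=0$ and $H(y)=0$ for all $y\notin\mathbb Z^d_{0+}$. Separating levels. If $\alpha(n)<\infty$, $k\in\{0,\dots,n\}$ is an $n$-separating level if $\sup_{0\le t<\alpha(k)}S_t[1]<k=S_{\alpha(k)}[1]\le\inf_{\alpha(k)<t<\alpha(n)}S_t[1]$. On $B_n$, $\eta_*(n)+1$ is the number of $n$-separating levels; off $B_n$, $\eta_*(n)=-1$. If $\eta_*(n)\ge1$, $\varkappa_*(n)$ is the largest $n$-separating level $k<n$; otherwise $\varkappa_*(n)=-\infty$. Constants. Under (A1)–(A4)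 it is known (an earlier theorem of the paper) that there is a (necessarily unique) $q\in(0,1]$ with $\sum_{k\ge1}\mathbf P_0(\varkappa_*(k)=0)/q^k=1$, and that then $1\le\mu:=\sum_{k\ge1}k\mathbf P_0(\varkappa_*(k)=0)/q^k<\infty$ and $0<\psi_0:=\sum_{m\ge0}\mathbf P_*(\eta_*(m)=0)/q^m<\infty$. Core sequence. On some probability space with probability $\mathbf P$, take mutually independent random blocks $(\overline\nu_0,\overline T_0,(\overline S_0,\dots,\overline S_{\overline T_0}))$ and $(\overline\lambda_i,\overline\tau_i,(\overline Y_{i,1},\dots,\overline Y_{i,\overline\tau_i}))$, $i\ge1$, the latter identically distributed, with laws: for integers $K\ge k\ge0$ and $\vec y\in(\mathbb Z^d)^{K+1}$, $$\mathbf P(\overline\nu_0=k,\overline T_0=K,(\overline S_0,\dots,\overline S_K)=\vec y)=\frac{\mathbf P_*(\alpha(k)=K<T_*,\,\eta_*(k)=0,\,(S_0,\dots,S_K)=\vec y)}{\psi_0q^k};$$ for integers $L\ge l\ge1$ and $\vec x\in(\mathbb Z^d)^L$, $$\mathbf P(\overline\lambda_i=l,\overline\tau_i=L,(\overline Y_{i,1},\dots,\overline Y_{i,L})=\vec x)=\frac{\mathbf P_0(\alpha(l)=L<T_*,\,\varkappa_*(l)=0,\,(S_1-S_0,\dots,S_L-S_0)=\vec x)}{q^l}.$$ Put $\overline\nu_m=\overline\nu_0+\sum_{i=1}^m\overline\lambda_i$, $\overline T_m=\overline T_0+\sum_{i=1}^m\overline\tau_i$, and define recursively $\overline S_{\overline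 T_{i-1}+j}=\overline S_{\overline T_{i-1}}+\overline Y_{i,j}$ for $1\le j\le\overline\tau_i$, $i\ge1$. The resulting $\{\overline S_t\}_{t\ge0}$ is the core sequence. *)

theory Defs
  imports "HOL-Probability.Probability"
begin

text \<open>
  The dimension of the lattice is \<open>CARD('d)\<close>.  The sort \<open>{finite, one}\<close> only serves to write
  the first coordinate of \<open>x\<close> as \<open>x $ 1\<close>; the constant \<open>1 :: 'd\<close> is subject to no law, so it
  is just a distinguished index.  Times at which something happens are of type
  \<open>enat\<close>, where \<open>Inf {} = \<infinity>\<close>.  All random elements below take values in countable types,
  which carry the discrete sigma-algebra.
\<close>

type_synonym 'd lattice = "int ^ 'd"


section \<open>Trajectories in a constraint field\<close>

definition upper_half :: "('d::{finite, one} lattice) set" where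
  "upper_half = {x. 0 \<le> x $ 1}"

definition walk ::
  "('w \<Rightarrow> 'd::{finite, one} lattice) \<Rightarrow> (nat \<Rightarrow> 'w \<Rightarrow> 'd lattice) \<Rightarrow> 'w \<Rightarrow> nat \<Rightarrow> 'd lattice" where
  "walk S0 \<xi> \<omega> t = S0 \<omega> + (\<Sum>j=1..t. \<xi> j \<omega>)"

text \<open>In the following, \<open>S\<close> is one trajectory and \<open>h\<close> one realization of the constraints.\<close>

definition local_time :: "(nat \<Rightarrow> 'd::{finite, one} lattice) \<Rightarrow> nat \<Rightarrow> 'd lattice \<Rightarrow> nat" where
  "local_time S t x = (\<Sum>j=0..t. of_bool (S j = x))"

definition death_time ::
  "(nat \<Rightarrow> 'd::{finite, one} lattice) \<Rightarrow> ('d lattice \<Rightarrow> enat) \<Rightarrow> enat" where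
  "death_time S h = Inf {enat t |t. enat (local_time S t (S t)) > h (S t)}"

definition alpha :: "(nat \<Rightarrow> 'd::{finite, one} lattice) \<Rightarrow> nat \<Rightarrow> enat" where
  "alpha S n = Inf {enat t |t. S t $ 1 \<ge> int n}"

text \<open>The event \<open>B\<^sub>n\<close>:\<close>

definition survives_to ::
  "(nat \<Rightarrow> 'd::{finite, one} lattice) \<Rightarrow> ('d lattice \<Rightarrow> enat) \<Rightarrow> nat \<Rightarrow> bool" where
  "survives_to S h n \<longleftrightarrow> alpha S n < death_time S h"

text \<open>Suprema and infima are taken in \<open>ereal\<close>, so that they are \<open>- \<infinity>\<close> and \<open>\<infinity>\<close> on the empty set.\<close>

definition separating_level :: "(nat \<Rightarrow> 'd::{finite, one} lattice) \<Rightarrow> nat \<Rightarrow> nat \<Rightarrow> bool" where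
  "separating_level S n k \<longleftrightarrow>
     alpha S n < \<infinity> \<and> k \<le> n \<and>
     (SUP t\<in>{t. enat t < alpha S k}. ereal (real_of_int (S t $ 1))) < ereal (real k) \<and>
     S (the_enat (alpha S k)) $ 1 = int k \<and>
     ereal (real k) \<le>
       (INF t\<in>{t. alpha S k < enat t \<and> enat t < alpha S n}. ereal (real_of_int (S t $ 1)))"

definition eta ::
  "(nat \<Rightarrow> 'd::{finite, one} lattice) \<Rightarrow> ('d lattice \<Rightarrow> enat) \<Rightarrow> nat \<Rightarrow> int" where
  "eta S h n =
     (if survives_to S h n then int (card {k. separating_level S n k}) - 1 else -1)"

definition kappa ::
  "(nat \<Rightarrow> 'd::{finite, one} lattice) \<Rightarrow> ('d lattice \<Rightarrow> enat) \<Rightarrow> nat \<Rightarrow> ereal" where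
  "kappa S h n =
     (if eta S h n \<ge> 1 then ereal (real (Max {k. separating_level S n k \<and> k < n})) else -\<infinity>)"

definition first_zero :: "(nat \<Rightarrow> 'a::zero) \<Rightarrow> enat" where
  "first_zero f = Inf {enat t |t. 0 < t \<and> f t = 0}"


section \<open>The model\<close>

definition generated_events ::
  "'w measure \<Rightarrow> ('i \<Rightarrow> 'w \<Rightarrow> 'a) \<Rightarrow> 'i set \<Rightarrow> 'w set set" where
  "generated_events M X I = sigma_sets (space M) {X i -` A \<inter> space M |i A. i \<in> I}"

text \<open>
  The increments are \<open>\<xi> 1, \<xi> 2, \<dots>\<close>; the value \<open>\<xi> 0\<close> is not used.  The assumptions \<open>A1_\<close>, \<open>A2_\<close>,
  \<open>A3_\<close>, \<open>A4_\<close> are grouped as in the four standing hypotheses on the model.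
\<close>

locale constrained_walk = prob_space M
  for M :: "'w measure"
    and S0 :: "'w \<Rightarrow> 'd::{finite, one} lattice"
    and \<xi> :: "nat \<Rightarrow> 'w \<Rightarrow> 'd lattice"
    and H :: "'d lattice \<Rightarrow> 'w \<Rightarrow> enat" +
  assumes S0_measurable: "S0 \<in> measurable M (count_space UNIV)"
    and xi_measurable: "\<And>i. i \<ge> 1 \<Longrightarrow> \<xi> i \<in> measurable M (count_space UNIV)"
    and H_measurable: "\<And>x. H x \<in> measurable M (count_space UNIV)"
    and A1_indep: "indep_vars (\<lambda>_. count_space UNIV) \<xi> {1..}"
    and A1_ident: "\<And>i. i \<ge> 1 \<Longrightarrow>
      distr M (count_space UNIV) (\<xi> i) = distr M (count_space UNIV) (\<xi> 1)"
    and A1_le: "\<P>(\<omega> in M. \<xi> 1 \<omega> $ 1 \<le> 1) = 1"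
    and A1_pos: "\<P>(\<omega> in M. \<xi> 1 \<omega> $ 1 = 1) > 0"
    and A2_indep: "indep_sets
      (\<lambda>j. [sigma_sets (space M)
              (generated_events M (\<lambda>_::unit. S0) UNIV \<union> generated_events M H (- upper_half)),
            generated_events M \<xi> {1..},
            generated_events M H upper_half] ! j) {..<3}"
    and A2_start: "AE \<omega> in M. S0 \<omega> $ 1 \<le> 0"
    and A2_pos: "\<P>(\<omega> in M. survives_to (walk S0 \<xi> \<omega>) (\<lambda>x. H x \<omega>) 0) > 0"
    and A3_indep: "indep_vars (\<lambda>_. count_space UNIV) H upper_half"
    and A3_ident: "\<And>x. x \<in> upper_half \<Longrightarrow>
      distr M (count_space UNIV) (H x) = distr M (count_space UNIV) (H 0)"
    and A3_ge: "\<P>(\<omega> in M. 1 \<le> H 0 \<omega>) = 1"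
    and A4_return:
      "\<P>(\<omega> in M. first_zero (\<lambda>t. \<Sum>j=1..t. \<xi> j \<omega> $ 1) < \<infinity>) = 1 \<Longrightarrow>
       \<P>(\<omega> in M. first_zero (\<lambda>t. \<Sum>j=1..t. \<xi> j \<omega>) < \<infinity>) > 0"
    and A4_expectation:
      "\<P>(\<omega> in M. first_zero (\<lambda>t. \<Sum>j=1..t. \<xi> j \<omega> $ 1) = first_zero (\<lambda>t. \<Sum>j=1..t. \<xi> j \<omega>) \<and>
                 first_zero (\<lambda>t. \<Sum>j=1..t. \<xi> j \<omega>) < \<infinity>) = 1 \<Longrightarrow>
       (\<integral>\<^sup>+ \<omega>. ennreal_of_enat (H 0 \<omega>) \<partial>M) < \<infinity>"

text \<open>
  The probability \<open>P\<^sub>0\<close> is realized on the same space \<open>M\<close>: increments and constraints in the upper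
  half space are kept, the start is replaced by \<open>0\<close> and the remaining constraints by \<open>0\<close>.  A
  \<open>P\<^sub>0\<close>-probability is thus a probability under \<open>M\<close> of an event about \<open>walk (\<lambda>_. 0) \<xi> \<omega>\<close> and
  \<open>half_constraint H \<omega>\<close>.
\<close>

definition half_constraint ::
  "('d::{finite, one} lattice \<Rightarrow> 'w \<Rightarrow> enat) \<Rightarrow> 'w \<Rightarrow> 'd lattice \<Rightarrow> enat" where
  "half_constraint H \<omega> x = (if x \<in> upper_half then H x \<omega> else 0)"


section \<open>The constants and the core sequence\<close>

definition is_core_rate ::
  "'w measure \<Rightarrow> (nat \<Rightarrow> 'w \<Rightarrow> 'd::{finite, one} lattice) \<Rightarrow> ('d lattice \<Rightarrow> 'w \<Rightarrow> enat) \<Rightarrow>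
   real \<Rightarrow> bool" where
  "is_core_rate M \<xi> H q \<longleftrightarrow> 0 < q \<and> q \<le> 1 \<and>
     (\<lambda>i. \<P>(\<omega> in M. kappa (walk (\<lambda>_. 0) \<xi> \<omega>) (half_constraint H \<omega>) (Suc i) = 0) / q ^ Suc i)
       sums 1"

definition is_core_norm ::
  "'w measure \<Rightarrow> ('w \<Rightarrow> 'd::{finite, one} lattice) \<Rightarrow> (nat \<Rightarrow> 'w \<Rightarrow> 'd lattice) \<Rightarrow>
   ('d lattice \<Rightarrow> 'w \<Rightarrow> enat) \<Rightarrow> real \<Rightarrow> real \<Rightarrow> bool" where
  "is_core_norm M S0 \<xi> H q \<psi>0 \<longleftrightarrow>
     (\<lambda>m. \<P>(\<omega> in M. eta (walk S0 \<xi> \<omega>) (\<lambda>x. H x \<omega>) m = 0) / q ^ m) sums \<psi>0"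

text \<open>
  A block \<open>(l, L, xs)\<close> consists of a height, a duration and a list of points.  Block \<open>0\<close> is the
  initial one, and its list holds the \<open>L + 1\<close> positions at times \<open>0, \<dots>, L\<close>.  In a block with index
  at least \<open>1\<close>, the list holds the \<open>L\<close> displacements from the starting position of the block.  The
  weights prescribed below sum to \<open>1\<close>, so they determine the laws of the blocks; in particular all
  blocks except the initial one have the same law.
\<close>

type_synonym 'd block = "nat \<times> nat \<times> 'd lattice list"

definition block_height :: "'d block \<Rightarrow> nat" where
  "block_height b = fst b"

definition block_duration :: "'d block \<Rightarrow> nat" where
  "block_duration b = fst (snd b)"

definition block_points :: "'d block \<Rightarrow> 'd lattice list" where
  "block_points b = snd (snd b)"

definition core_blocks ::
  "'w measure \<Rightarrow> ('w \<Rightarrow> 'd::{finite, one} lattice) \<Rightarrow> (nat \<Rightarrow> 'w \<Rightarrow> 'd lattice) \<Rightarrow>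
   ('d lattice \<Rightarrow> 'w \<Rightarrow> enat) \<Rightarrow> real \<Rightarrow> real \<Rightarrow> 'v measure \<Rightarrow> (nat \<Rightarrow> 'v \<Rightarrow> 'd block) \<Rightarrow> bool" where
  "core_blocks M S0 \<xi> H q \<psi>0 N b \<longleftrightarrow>
     prob_space.indep_vars N (\<lambda>_. count_space UNIV) b UNIV \<and>
     (\<forall>k K ys. k \<le> K \<longrightarrow> length ys = K + 1 \<longrightarrow>
        \<P>(v in N. b 0 v = (k, K, ys)) =
        \<P>(\<omega> in M. alpha (walk S0 \<xi> \<omega>) k = enat K \<and>
                   enat K < death_time (walk S0 \<xi> \<omega>) (\<lambda>x. H x \<omega>) \<and>
                   eta (walk S0 \<xi> \<omega>) (\<lambda>x. H x \<omega>) k = 0 \<and>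
                   map (walk S0 \<xi> \<omega>) [0..<K + 1] = ys) / (\<psi>0 * q ^ k)) \<and>
     (\<forall>i\<ge>1. \<forall>l L xs. 1 \<le> l \<longrightarrow> l \<le> L \<longrightarrow> length xs = L \<longrightarrow>
        \<P>(v in N. b i v = (l, L, xs)) =
        \<P>(\<omega> in M. alpha (walk (\<lambda>_. 0) \<xi> \<omega>) l = enat L \<and>
                   enat L < death_time (walk (\<lambda>_. 0) \<xi> \<omega>) (half_constraint H \<omega>) \<and>
                   kappa (walk (\<lambda>_. 0) \<xi> \<omega>) (half_constraint H \<omega>) l = 0 \<and>
                   map (\<lambda>t. walk (\<lambda>_. 0) \<xi> \<omega> t - walk (\<lambda>_. 0) \<xi> \<omega> 0) [1..<L + 1] = xs) / q ^ l)"

text \<open>The next three functions act on one realization of the sequence of blocks.\<close>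

definition core_level :: "(nat \<Rightarrow> 'd block) \<Rightarrow> nat \<Rightarrow> nat" where
  "core_level b m = (\<Sum>i\<le>m. block_height (b i))"

definition core_time :: "(nat \<Rightarrow> 'd block) \<Rightarrow> nat \<Rightarrow> nat" where
  "core_time b m = (\<Sum>i\<le>m. block_duration (b i))"

lemma core_time_mono: "i \<le> j \<Longrightarrow> core_time b i \<le> core_time b j"
  unfolding core_time_def by (intro sum_mono2) auto

lemma core_time_pred_Least:
  assumes "\<exists>i. t \<le> core_time b i" and "\<not> t \<le> core_time b 0"
  shows "core_time b ((LEAST i. t \<le> core_time b i) - 1) < t"
proof -
  define k where "k = (LEAST i. t \<le> core_time b i)"
  have "t \<le> core_time b k" using assms(1) unfolding k_def by (metis LeastI)
  with assms(2) have "k - 1 < k" by (cases k) auto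
  then have "\<not> t \<le> core_time b (k - 1)" unfolding k_def by (rule not_less_Least)
  then show ?thesis unfolding k_def by simp
qed

text \<open>
  The index \<open>i\<close> in the recursion is the one with \<open>core_time b (i - 1) < t \<le> core_time b i\<close>.  The
  last branch is reached only if the total duration of all blocks is less than \<open>t\<close>, which has
  probability \<open>0\<close> since almost surely every block except the initial one has duration at least \<open>1\<close>.
\<close>

function core_seq :: "(nat \<Rightarrow> 'd::{finite, one} block) \<Rightarrow> nat \<Rightarrow> 'd lattice" where
  "core_seq b t =
     (if t \<le> core_time b 0 then block_points (b 0) ! t
      else if \<exists>i. t \<le> core_time b i then
        (let i = (LEAST i. t \<le> core_time b i); s = core_time b (i - 1)
         in core_seq b s + block_points (b i) ! (t - s - 1))
      else 0)"
  by pat_completeness auto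
termination
  by (relation "Wellfounded.measure snd") (use core_time_pred_Least in auto)

declare core_seq.simps [simp del]

lemma core_seq_initial: "t \<le> core_time b 0 \<Longrightarrow> core_seq b t = block_points (b 0) ! t"
  by (simp add: core_seq.simps)

lemma core_seq_step:
  assumes "1 \<le> i" and "1 \<le> j" and "j \<le> block_duration (b i)"
  shows "core_seq b (core_time b (i - 1) + j) =
         core_seq b (core_time b (i - 1)) + block_points (b i) ! (j - 1)"
proof -
  let ?t = "core_time b (i - 1) + j"
  have "core_time b i = core_time b (i - 1) + block_duration (b i)"
    using assms(1) by (cases i) (simp_all add: core_time_def)
  then have t: "?t \<le> core_time b i" using assms(3) by simp
  have "(LEAST i. ?t \<le> core_time b i) = i"
  proof (rule Least_equality)
    fix k assume k: "?t \<le> core_time b k"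
    show "i \<le> k"
    proof (rule ccontr)
      assume "\<not> i \<le> k"
      then have "core_time b k \<le> core_time b (i - 1)" by (intro core_time_mono) simp
      with k assms(2) show False by simp
    qed
  qed (rule t)
  moreover have "\<not> ?t \<le> core_time b 0"
    using core_time_mono[of 0 "i - 1" b] assms(2) by simp
  ultimately show ?thesis
    using t by (subst core_seq.simps) (auto simp: Let_def)
qed

definition initial_path :: "(nat \<Rightarrow> 'd lattice) \<Rightarrow> enat \<Rightarrow> 'd lattice list" where
  "initial_path S a = map S [0..<the_enat a + 1]"

end

theory Submission
  imports Defs
begin

text \<open>
  The law of the walk together with the event of survival, restricted to a fixed finite path
  \<open>p\<close>, is a product of three factors: the law of the start and of the constraints outside the upper
  half space, the probabilities of the steps, and for every visited site of the upper half space the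
  probability that its constraint admits the number of visits.  If \<open>p\<close> passes through a separating
  level at the point \<open>c\<close>, the sites visited before \<open>c\<close> lie below that level and those visited from
  \<open>c\<close> on do not.  Hence no site is shared, and since \<open>H \<ge> 1\<close> almost surely, the product splits at \<open>c\<close>
  into the weight of the path up to \<open>c\<close> and the weight under \<open>P\<^sub>0\<close> of the rest translated to the origin.
  Cutting \<open>p\<close> at all its \<open>m + 1\<close> separating levels is a bijection onto the tuples of
  blocks \<open>0, \<dots>, m\<close>, and the factors \<open>q ^ l\<close> of the block laws telescope to \<open>q ^ n\<close>.  As the
  weights of the blocks sum to \<open>1\<close>, almost surely all blocks arise in this way.
\<close>

section \<open>Separating levels of finite paths\<close>

text \<open>The events of the model are phrased through infima and suprema over an infinite
  trajectory. Prescribing the path p up to alpha(n) turns such an event into a deterministic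
  condition on the list p together with a finite event about the start, the steps and the
  constraints. Cuts are made one at a time, at the largest separating level below the endpoint. That
  level can be read off from p, which makes the gluing of blocks injective. Paths whose height jumps
  up by more than one cannot be split in this way, but they have weight 0. On the core side, the
  path formed by blocks 0, ..., m ends exactly when the level nu_m is first reached; on nu_m = n the
  later blocks therefore have no influence. The block laws are prescribed only for certain triples.
  That no mass lies elsewhere is drawn from the series for q and psi0, and psi0 > 0 comes from
  P_*(B_0) > 0.\<close>

definition levels :: "'d::{finite, one} lattice list \<Rightarrow> nat set" where
  "levels p = {k. \<exists>u x v. p = u @ x # v \<and> x $ 1 = int k \<and>
                 (\<forall>y\<in>set u. y $ 1 < int k) \<and> (\<forall>y\<in>set v. int k \<le> y $ 1)}"

text \<open>The last height is only bounded below, as in \<open>alpha\<close>; that it equals n is a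
  consequence of skip-freeness.\<close>

definition first_passage :: "nat \<Rightarrow> 'd::{finite, one} lattice list \<Rightarrow> bool" where
  "first_passage n p \<longleftrightarrow> p \<noteq> [] \<and> int n \<le> last p $ 1 \<and> (\<forall>y\<in>set (butlast p). y $ 1 < int n)"

text \<open>These two conditions are the traces of (A1) and (A2) on a single path: a start at height
  at most 0 and steps that raise the height by at most 1. They hold for every path of positive
  weight.\<close>

definition skip_free :: "'d::{finite, one} lattice list \<Rightarrow> bool" where
  "skip_free p \<longleftrightarrow> p \<noteq> [] \<and> hd p $ 1 \<le> 0 \<and> successively (\<lambda>x y. y $ 1 \<le> x $ 1 + 1) p"

text \<open>
  \<open>passage_path m n p\<close>: \<open>p\<close> ends on first reaching level \<open>n\<close>, and \<open>\<eta>\<^sub>*(n) = m\<close> along \<open>p\<close>;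
  \<open>block_path l xs\<close>: \<open>\<kappa>\<^sub>*(l) = 0\<close> along the path from \<open>0\<close> with displacements \<open>xs\<close>.
\<close>

definition passage_path :: "nat \<Rightarrow> nat \<Rightarrow> 'd::{finite, one} lattice list \<Rightarrow> bool" where
  "passage_path m n p \<longleftrightarrow> skip_free p \<and> first_passage n p \<and> card (levels p) = Suc m"

definition block_path :: "nat \<Rightarrow> 'd::{finite, one} lattice list \<Rightarrow> bool" where
  "block_path l xs \<longleftrightarrow> 1 \<le> l \<and> skip_free (0 # xs) \<and> first_passage l (0 # xs) \<and> levels (0 # xs) = {0, l}"

text \<open>The prefix in \<open>levels\<close> is forced to be the longest one below height k. This
  replaces the existential decomposition by a term that computes on appended and mapped
  lists.\<close>

lemma mem_levels_dropWhile:
  "k \<in> levels p \<longleftrightarrow> (\<exists>x v. dropWhile (\<lambda>y. y $ 1 < int k) p = x # v \<and> x $ 1 = int k \<and>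
     (\<forall>y\<in>set v. int k \<le> y $ 1))" (is "?L \<longleftrightarrow> ?R")
proof
  assume ?L
  then obtain u x v where "p = u @ x # v" "x $ 1 = int k" "\<forall>y\<in>set u. y $ 1 < int k"
    "\<forall>y\<in>set v. int k \<le> y $ 1" unfolding levels_def by blast
  then show ?R by (simp add: dropWhile_append2)
next
  assume ?R
  then obtain x v where "dropWhile (\<lambda>y. y $ 1 < int k) p = x # v" "x $ 1 = int k"
     "\<forall>y\<in>set v. int k \<le> y $ 1" by blast
  then have "p = takeWhile (\<lambda>y. y $ 1 < int k) p @ x # v" by (metis takeWhile_dropWhile_id)
  then show ?L unfolding levels_def using \<open>x $ 1 = int k\<close> \<open>\<forall>y\<in>set v. int k \<le> y $ 1\<close>
    by (intro CollectI exI conjI) (auto dest: set_takeWhileD)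
qed

lemma levels_le_last: "k \<in> levels p \<Longrightarrow> int k \<le> last p $ 1"
  unfolding levels_def by (auto simp: last_append) 

lemma finite_levels: "finite (levels p)"
proof (rule finite_subset)
  show "levels p \<subseteq> {..nat (last p $ 1)}" using levels_le_last by fastforce
qed simp

text \<open>The points from c on have height at least k and so violate nothing. If u reaches height
  k, the candidate point lies in u; otherwise it is c.\<close>

lemma levels_append_le:
  assumes "\<forall>y\<in>set v. c $ 1 \<le> y $ 1" "int k \<le> c $ 1"
  shows "k \<in> levels (u @ c # v) \<longleftrightarrow> k \<in> levels (u @ [c])"
proof (cases "\<forall>y\<in>set u. y $ 1 < int k")
  case True
  then show ?thesis using assms by (fastforce simp: mem_levels_dropWhile dropWhile_append2)
next
  case False
  then obtain y where y: "y \<in> set u" "\<not> y $ 1 < int k" by blast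
  have 1: "dropWhile (\<lambda>y. y $ 1 < int k) (u @ w) = dropWhile (\<lambda>y. y $ 1 < int k) u @ w" for w
    using y by (rule dropWhile_append1)
  have "dropWhile (\<lambda>y. y $ 1 < int k) u \<noteq> []" using y by auto
  then obtain x t where "dropWhile (\<lambda>y. y $ 1 < int k) u = x # t" by (meson neq_Nil_conv)
  then show ?thesis using assms unfolding mem_levels_dropWhile 1 by fastforce
qed

lemma levels_append_ge:
  assumes "\<forall>y\<in>set u. y $ 1 < int k"
  shows "k \<in> levels (u @ v) \<longleftrightarrow> k \<in> levels v"
  using assms by (simp add: mem_levels_dropWhile dropWhile_append2)

lemma levels_shift:
  assumes "c $ 1 = int k"
  shows "k + l \<in> levels (map ((+) c) p) \<longleftrightarrow> l \<in> levels p"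
proof -
  have "(\<lambda>y. y $ 1 < int (k + l)) \<circ> (+) c = (\<lambda>y. y $ 1 < int l)" using assms by auto
  then show ?thesis
    unfolding mem_levels_dropWhile dropWhile_map using assms by (auto simp: map_eq_Cons_conv)
qed

text \<open>Steps up of at most 1 cannot jump over level n. A path with a single point is covered by
  the condition on the start: its height is at most 0 and at least n, so n = 0.\<close>

lemma passage_pathD:
  assumes "skip_free p" "first_passage n p"
  shows "last p $ 1 = int n" "n \<in> levels p" "levels p \<subseteq> {..n}"
proof -
  have p: "p = butlast p @ [last p]" and ne: "p \<noteq> []" using assms by (auto simp: first_passage_def)
  show l: "last p $ 1 = int n"
  proof (cases "butlast p = []")
    case True
    then have "p = [last p]" using p by simp
    then have "hd p = last p" by (metis list.sel(1))
    then show ?thesis using assms by (auto simp: skip_free_def first_passage_def)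
  next
    case False
    have "successively (\<lambda>x y. y $ 1 \<le> x $ 1 + 1) (butlast p @ [last p])"
      using assms(1) p unfolding skip_free_def by simp
    then have "last p $ 1 \<le> last (butlast p) $ 1 + 1" using False by (simp add: successively_append_iff)
    moreover have "last (butlast p) $ 1 < int n" using assms(2) False by (auto simp: first_passage_def)
    ultimately show ?thesis using assms(2) by (auto simp: first_passage_def)
  qed
  show "n \<in> levels p" unfolding levels_def using p l assms(2) unfolding first_passage_def
    by (intro CollectI exI[of _ "butlast p"] exI[of _ "last p"] exI[of _ "[]"]) auto
  show "levels p \<subseteq> {..n}" using levels_le_last l by fastforce
qed

lemma skip_free_nth_le:
  "skip_free p \<Longrightarrow> i < length p \<Longrightarrow> p ! i $ 1 \<le> int i"
proof (induction i)
  case 0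
  then show ?case by (auto simp: skip_free_def hd_conv_nth)
next
  case (Suc i)
  then have "p ! Suc i $ 1 \<le> p ! i $ 1 + 1"
    unfolding skip_free_def by (simp add: successively_conv_nth)
  then show ?case using Suc by simp
qed

text \<open>Climbing to height n takes at least n steps. This supplies the inequalities between
  height and duration under which the block laws are prescribed.\<close>

lemma first_passage_le_length:
  assumes "skip_free p" "first_passage n p"
  shows "n < length p"
proof -
  have "p \<noteq> []" using assms(1) by (simp add: skip_free_def)
  then have "int n \<le> int (length p - 1)"
    using skip_free_nth_le[OF assms(1), of "length p - 1"] assms(2)
    by (auto simp: first_passage_def last_conv_nth)
  then show ?thesis using \<open>p \<noteq> []\<close> by (cases p) auto
qed

text \<open>A joined path is always written with \<open>map ((+) c) (0 # xs)\<close>: the cut point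
  c is the endpoint of the first piece and at the same time the image of the origin of the
  second.\<close>

lemma skip_free_concat:
  assumes "0 \<le> c $ 1"
  shows "skip_free (u @ map ((+) c) (0 # xs)) \<longleftrightarrow> skip_free (u @ [c]) \<and> skip_free (0 # xs)"
proof -
  have "successively (\<lambda>x y. y $ 1 \<le> x $ 1 + 1) (map ((+) c) (0 # xs)) \<longleftrightarrow>
    successively (\<lambda>x y. y $ 1 \<le> x $ 1 + 1) (0 # xs)"
    unfolding successively_map by simp
  then show ?thesis
    by (auto simp: skip_free_def successively_append_iff hd_append)
qed

lemma first_passage_concat:
  assumes "c $ 1 = int k" "\<forall>y\<in>set u. y $ 1 < int k" 
  shows "first_passage (k + l) (u @ map ((+) c) (0 # xs)) \<longleftrightarrow> first_passage l (0 # xs)"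
proof -
  have "butlast (u @ map ((+) c) (0 # xs)) = u @ map ((+) c) (butlast (0 # xs))"
    unfolding butlast_append map_butlast by simp
  moreover have "last (u @ map ((+) c) (0 # xs)) = c + last (0 # xs)"
    by (simp add: last_map)
  ultimately show ?thesis using assms unfolding first_passage_def by (force simp del: butlast.simps)
qed

text \<open>Levels up to k do not notice what happens from c on, and levels from k on do not notice
  u. The level k itself is seen from both sides, as the top of the first piece and as the level 0 of
  the second.\<close>

lemma levels_concat:
  assumes "c $ 1 = int k" "\<forall>y\<in>set u. y $ 1 < int k" "\<forall>y\<in>set xs. 0 \<le> y $ 1"
  shows "levels (u @ map ((+) c) (0 # xs)) \<inter> {..k} = levels (u @ [c])"
    and "levels (u @ map ((+) c) (0 # xs)) \<inter> {k..} = (+) k ` levels (0 # xs)"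
proof -
  have *: "i \<le> k" if "i \<in> levels (u @ [c])" for i using levels_le_last[OF that] assms(1) by simp
  have "i \<in> levels (u @ map ((+) c) (0 # xs)) \<longleftrightarrow> i \<in> levels (u @ [c])" if "i \<le> k" for i
    using levels_append_le[of "map ((+) c) xs" c i u] assms that by simp
  with * show "levels (u @ map ((+) c) (0 # xs)) \<inter> {..k} = levels (u @ [c])" by auto
  have "k + j \<in> levels (u @ map ((+) c) (0 # xs)) \<longleftrightarrow> j \<in> levels (0 # xs)" for j
    using levels_append_ge[of u "k + j" "map ((+) c) (0 # xs)"] levels_shift[OF assms(1), of j "0 # xs"] assms(2)
    by force
  then show "levels (u @ map ((+) c) (0 # xs)) \<inter> {k..} = (+) k ` levels (0 # xs)"
    by (auto simp: image_iff le_iff_add)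
qed

text \<open>The prefix below height 0 is empty here, since the path starts at 0. This reconciles the
  separating level 0 with the constraint 0 outside the upper half space: a block path never leaves
  that half space.\<close>

lemma zero_mem_levels_Cons: "0 \<in> levels (0 # xs) \<longleftrightarrow> (\<forall>y\<in>set xs. 0 \<le> y $ 1)"
  by (auto simp: mem_levels_dropWhile)

lemma first_passage_snoc: "first_passage n (u @ [c]) \<longleftrightarrow> int n \<le> c $ 1 \<and> (\<forall>y\<in>set u. y $ 1 < int n)"
  by (simp add: first_passage_def)

text \<open>A block brings the levels k and k + l, of which only k + l is new. The second claim
  recovers the cut level from the joined path and is the source of uniqueness.\<close>

lemma passage_path_concat:
  assumes p: "passage_path m k (u @ [c])" and xs: "block_path l xs"
  shows "passage_path (Suc m) (k + l) (u @ map ((+) c) (0 # xs))"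
    and "Max (levels (u @ map ((+) c) (0 # xs)) - {k + l}) = k"
proof -
  let ?p = "u @ map ((+) c) (0 # xs)"
  have c: "c $ 1 = int k" and k: "k \<in> levels (u @ [c])" "levels (u @ [c]) \<subseteq> {..k}"
    using passage_pathD[of "u @ [c]" k] p by (auto simp: passage_path_def)
  have u: "\<forall>y\<in>set u. y $ 1 < int k" using p by (simp add: passage_path_def first_passage_snoc)
  have x: "\<forall>y\<in>set xs. 0 \<le> y $ 1" using xs zero_mem_levels_Cons by (auto simp: block_path_def)
  have l: "levels (0 # xs) = {0, l}" "1 \<le> l" using xs by (auto simp: block_path_def)
  have "levels ?p = levels ?p \<inter> {..k} \<union> levels ?p \<inter> {k..}" by auto
  also have "\<dots> = levels (u @ [c]) \<union> {k, k + l}" unfolding levels_concat[OF c u x] l(1) by simp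
  finally have L: "levels ?p = insert (k + l) (levels (u @ [c]))" using k by blast
  have "k + l \<notin> levels (u @ [c])" using k l by auto
  then have "card (levels ?p) = Suc (Suc m)" unfolding L using p by (simp add: passage_path_def finite_levels)
  moreover have "skip_free ?p" using skip_free_concat[of c u xs] c p xs
    by (simp add: passage_path_def block_path_def)
  moreover have "first_passage (k + l) ?p" using first_passage_concat[OF c u] xs
    by (simp add: block_path_def)
  ultimately show "passage_path (Suc m) (k + l) ?p" by (simp add: passage_path_def)
  have "levels ?p - {k + l} = levels (u @ [c])" unfolding L using \<open>k + l \<notin> _\<close> by auto
  moreover have "Max (levels (u @ [c])) = k" using k by (intro Max_eqI finite_levels) auto
  ultimately show "Max (levels ?p - {k + l}) = k" by simp
qed

text \<open>The cut is made at the largest level k other than n, which exists because at least two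
  levels are present. As no level lies strictly between k and n, the part after the cut has exactly
  the levels 0 and n - k.\<close>

lemma passage_path_split:
  assumes p: "passage_path (Suc m) n p" 
  obtains u c xs k l where "p = u @ map ((+) c) (0 # xs)" "passage_path m k (u @ [c])" 
    "block_path l xs" "n = k + l"
proof -
  define k where "k = Max (levels p - {n})"
  have n: "n \<in> levels p" "levels p \<subseteq> {..n}" "skip_free p" "first_passage n p"
    using p passage_pathD[of p n] by (auto simp: passage_path_def)
  have card: "card (levels p - {n}) = Suc m" using p n by (simp add: passage_path_def finite_levels)
  then have "levels p - {n} \<noteq> {}" by (metis card.empty nat.distinct(1))
  then have "k \<in> levels p - {n}" unfolding k_def by (intro Max_in) (auto simp: finite_levels)
  then have k: "k \<in> levels p" "k < n" using n by auto
  have kmax: "i \<le> k" if "i \<in> levels p" "i \<noteq> n" for i 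
    unfolding k_def using that by (auto simp: finite_levels)
  obtain u c v where uv: "p = u @ c # v" "c $ 1 = int k" "\<forall>y\<in>set u. y $ 1 < int k"
    "\<forall>y\<in>set v. int k \<le> y $ 1" using k(1) unfolding levels_def by blast
  define xs where "xs = map (\<lambda>y. y - c) v"
  have pp: "p = u @ map ((+) c) (0 # xs)" unfolding uv(1) xs_def by (simp add: o_def)
  have x: "\<forall>y\<in>set xs. 0 \<le> y $ 1" unfolding xs_def using uv by auto
  define l where "l = n - k"
  have nl: "n = k + l" "1 \<le> l" using k unfolding l_def by auto
  note L = levels_concat[OF uv(2,3) x, folded pp]
  \<comment> \<open>By the maximality of k the first piece loses only the level n, so m + 1 levels
    remain.\<close>
  have lv: "levels (u @ [c]) = levels p - {n}" using L(1) kmax k by force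
  have "levels p \<inter> {k..} = {k, n}" using kmax k n(1) by force
  then have "(+) k ` levels (0 # xs) = (+) k ` {0, l}" unfolding L(2) using nl by simp
  then have lx: "levels (0 # xs) = {0, l}" by (subst (asm) inj_image_eq_iff) (auto simp: inj_def)
  have sf: "skip_free (u @ [c])" "skip_free (0 # xs)"
    using n(3) skip_free_concat[of c u xs] uv(2) unfolding pp by (simp_all only: of_nat_0_le_iff)
  have "first_passage l (0 # xs)"
    using n(4) first_passage_concat[OF uv(2,3), of l xs] unfolding pp nl by simp
  with lx sf nl have bl: "block_path l xs" by (simp add: block_path_def)
  have "first_passage k (u @ [c])" using uv by (simp add: first_passage_snoc)
  with lv sf card have "passage_path m k (u @ [c])" by (simp add: passage_path_def)
  from pp this bl nl(1) show thesis by (rule that)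
qed

text \<open>The path and its final height determine k as the largest level below the top, and then u
  is the longest prefix below height k.\<close>

lemma concat_unique:
  assumes "passage_path m k (u @ [c])" "block_path l xs"
    and "passage_path m' k' (u' @ [c'])" "block_path l' xs'"
    and "u @ map ((+) c) (0 # xs) = u' @ map ((+) c') (0 # xs')" and "k + l = k' + l'"
  shows "u = u'" "c = c'" "xs = xs'" "k = k'" "l = l'"
proof -
  show kk: "k = k'" "l = l'"
    using passage_path_concat(2)[OF assms(1,2)] passage_path_concat(2)[OF assms(3,4)] assms(5,6) by auto
  have tw: "takeWhile (\<lambda>y. y $ 1 < int k) (u @ map ((+) c) (0 # xs)) = u" 
    if "passage_path m k (u @ [c])" for m k u and c :: "'a lattice" and xs
    using that passage_pathD(1)[of "u @ [c]" k] 
    by (subst takeWhile_append2) (auto simp: passage_path_def first_passage_snoc)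
  show "u = u'" using tw[OF assms(1), of xs] tw[OF assms(3), of xs'] assms(5) kk by simp
  with assms(5) show c: "c = c'" by simp
  have "map ((+) c) xs = map ((+) c) xs'" using \<open>u = u'\<close> c assms(5) by simp
  then show "xs = xs'" by (rule map_injective) (simp add: inj_def)
qed

section \<open>Multiplicative weights of paths and their factorization at a cut\<close>

fun step_weight :: "('a::ab_group_add \<Rightarrow> real) \<Rightarrow> 'a list \<Rightarrow> real" where
  "step_weight a (x # y # p) = a (y - x) * step_weight a (y # p)"
| "step_weight a _ = 1"

text \<open>The point c is kept in both factors because the weight lives on increments: without it
  the step into c or the step out of c would be lost.\<close>

lemma step_weight_append: "step_weight a (u @ c # v) = step_weight a (u @ [c]) * step_weight a (c # v)"
proof (induction a u rule: step_weight.induct)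
  case ("2_2" a x)
  then show ?case by (cases v) auto
qed auto

lemma step_weight_shift: "step_weight a (map ((+) c) p) = step_weight a p"
  by (induction a p rule: step_weight.induct) auto

lemma step_weight_eq_prod: "step_weight a p = (\<Prod>i<length p - 1. a (p ! Suc i - p ! i))"
  by (induction a p rule: step_weight.induct) (auto simp: prod.lessThan_Suc_shift simp del: prod.lessThan_Suc)

text \<open>Only sites of the upper half space have independent constraints with a common law. The
  other sites are charged to the start, on which their constraints may depend.\<close>

definition site_weight :: "(nat \<Rightarrow> real) \<Rightarrow> 'd::{finite, one} lattice list \<Rightarrow> real" where
  "site_weight g p = (\<Prod>x\<in>set p \<inter> upper_half. g (count_list p x))"

lemma site_weight_append:
  assumes "set u \<inter> set v = {}"
  shows "site_weight g (u @ v) = site_weight g u * site_weight g v"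
proof -
  have z: "count_list u x = 0" if "x \<in> set v" for x using that assms by (intro count_notin) auto
  have z': "count_list v x = 0" if "x \<in> set u" for x using that assms by (intro count_notin) auto
  have "set (u @ v) \<inter> upper_half = (set u \<inter> upper_half) \<union> (set v \<inter> upper_half)" by auto
  then have "site_weight g (u @ v) = (\<Prod>x\<in>(set u \<inter> upper_half) \<union> (set v \<inter> upper_half). g (count_list (u @ v) x))"
    by (simp only: site_weight_def)
  also have "\<dots> = (\<Prod>x\<in>set u \<inter> upper_half. g (count_list (u @ v) x)) * (\<Prod>x\<in>set v \<inter> upper_half. g (count_list (u @ v) x))"
    using assms by (intro prod.union_disjoint) auto
  finally show ?thesis using z z' by (simp add: site_weight_def)
qed

lemma site_weight_shift:
  assumes "0 \<le> c $ 1" "set p \<subseteq> upper_half"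
  shows "site_weight g (map ((+) c) p) = site_weight g p"
proof -
  have "set (map ((+) c) p) \<inter> upper_half = (+) c ` set p" "set p \<inter> upper_half = set p" 
    using assms by (auto simp: upper_half_def)
  then show ?thesis unfolding site_weight_def
    by (simp add: prod.reindex inj_on_def count_list_map_conv inj_def)
qed

text \<open>The cut point is charged in both pieces. In \<open>u @ [c]\<close> it is visited once,
  as u stays strictly below it, and the factor \<open>g 1 = 1\<close> makes this harmless; this is
  where \<open>H\<close> being at least 1 enters. The last two claims say that sites outside the
  upper half space are visited only before the cut.\<close>

lemma weight_concat:
  assumes p: "passage_path m k (u @ [c])" and xs: "block_path l xs" and g: "g 1 = 1"
  shows "step_weight a (u @ map ((+) c) (0 # xs)) = step_weight a (u @ [c]) * step_weight a (0 # xs)" (is ?A)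
    and "site_weight g (u @ map ((+) c) (0 # xs)) = site_weight g (u @ [c]) * site_weight g (0 # xs)" (is ?B)
    and "set (0 # xs) \<subseteq> upper_half" (is ?C)
    and "set (u @ map ((+) c) (0 # xs)) - upper_half = set (u @ [c]) - upper_half" (is ?D)
    and "x \<notin> upper_half \<Longrightarrow> count_list (u @ map ((+) c) (0 # xs)) x = count_list (u @ [c]) x" (is "_ \<Longrightarrow> ?E")
proof -
  have c: "c $ 1 = int k"
    using passage_pathD[of "u @ [c]" k] p by (auto simp: passage_path_def)
  have u: "\<forall>y\<in>set u. y $ 1 < int k" using p by (simp add: passage_path_def first_passage_snoc)
  have x: "\<forall>y\<in>set xs. 0 \<le> y $ 1" using xs zero_mem_levels_Cons by (auto simp: block_path_def)
  show ?A using step_weight_append[of a u c "map ((+) c) xs"] step_weight_shift[of a c "0 # xs"] by simp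
  show C: ?C using x by (auto simp: upper_half_def)
  have ge: "int k \<le> y $ 1" if "y \<in> set (map ((+) c) (0 # xs))" for y using that c x by auto
  have "set u \<inter> set (map ((+) c) (0 # xs)) = {}" 
    using u ge by (meson disjoint_iff linorder_not_le)
  moreover have "set u \<inter> set [c] = {}" using u c by auto
  moreover have "site_weight g [c] = 1" using c g by (simp add: site_weight_def upper_half_def)
  moreover have "site_weight g (map ((+) c) (0 # xs)) = site_weight g (0 # xs)"
    using c C by (intro site_weight_shift) auto
  ultimately show ?B by (simp only: site_weight_append mult_1_right)
  have up: "set (map ((+) c) (0 # xs)) \<subseteq> upper_half" "c \<in> upper_half" using ge c unfolding upper_half_def by fastforce+
  then show ?D by auto
  show ?E if "x \<notin> upper_half" 
  proof -
    have "count_list (map ((+) c) (0 # xs)) x = 0" "count_list [c] x = 0"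
      using up that by (intro count_notin; force)+
    then show ?thesis by (simp del: count_list.simps)
  qed
qed

section \<open>Trajectories and their initial paths\<close>

text \<open>An infimum in \<open>enat\<close> is attained unless the set is empty, so a finite value
  of a hitting time is a statement about finitely many times.\<close>

lemma Inf_eq_enat_iff:
  fixes X :: "enat set"
  shows "Inf X = enat K \<longleftrightarrow> enat K \<in> X \<and> (\<forall>t<K. enat t \<notin> X)"
proof
  assume *: "Inf X = enat K"
  have "X \<noteq> {}"
  proof
    assume "X = {}"
    with * show False by (simp add: Inf_enat_def)
  qed
  then have "Inf X \<in> X" unfolding Inf_enat_def by (auto intro: LeastI)
  moreover have "enat t \<notin> X" if "t < K" for t
  proof
    assume "enat t \<in> X"
    then have "Inf X \<le> enat t" by (rule Inf_lower)
    with * that show False by simp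
  qed
  ultimately show "enat K \<in> X \<and> (\<forall>t<K. enat t \<notin> X)" using * by simp
next
  assume *: "enat K \<in> X \<and> (\<forall>t<K. enat t \<notin> X)"
  show "Inf X = enat K"
  proof (rule antisym)
    show "Inf X \<le> enat K" using * by (intro Inf_lower) auto
    show "enat K \<le> Inf X"
    proof (rule Inf_greatest)
      fix x assume "x \<in> X"
      with * show "enat K \<le> x" by (cases x) (auto simp: not_less[symmetric])
    qed
  qed
qed

lemma less_Inf_enat_iff:
  fixes X :: "enat set"
  shows "enat K < Inf X \<longleftrightarrow> (\<forall>t\<le>K. enat t \<notin> X)"
proof (cases "Inf X")
  case (enat L)
  then have "enat L \<in> X \<and> (\<forall>t<L. enat t \<notin> X)" by (simp add: Inf_eq_enat_iff)
  then show ?thesis unfolding enat by auto (meson leI)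
next
  case infinity
  have "enat t \<notin> X" for t
  proof
    assume "enat t \<in> X"
    then have "Inf X \<le> enat t" by (rule Inf_lower)
    with infinity show False by simp
  qed
  then show ?thesis unfolding infinity by simp
qed

lemma alpha_eq_iff: "alpha S n = enat K \<longleftrightarrow> int n \<le> S K $ 1 \<and> (\<forall>t<K. S t $ 1 < int n)"
  unfolding alpha_def Inf_eq_enat_iff by (simp add: not_le)

lemma alpha_eq_iff_first_passage: "alpha S n = enat K \<longleftrightarrow> first_passage n (map S [0..<Suc K])"
  by (auto simp: alpha_eq_iff first_passage_def)

lemma local_time_eq_count: "local_time S t x = count_list (map S [0..<Suc t]) x"
  by (induction t) (auto simp: local_time_def)

lemma local_time_mono: "s \<le> t \<Longrightarrow> local_time S s x \<le> local_time S t x"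
  unfolding local_time_def by (intro sum_mono2) auto

text \<open>The local time of a site stays constant after the last visit up to time K. Hence testing
  every visit when it occurs amounts to testing the totals at time K, which depend on the path only
  as a list.\<close>

lemma less_death_time_iff:
  "enat K < death_time S h \<longleftrightarrow>
     (\<forall>x\<in>set (map S [0..<Suc K]). enat (count_list (map S [0..<Suc K]) x) \<le> h x)"
proof -
  have "enat K < death_time S h \<longleftrightarrow> (\<forall>t\<le>K. enat (local_time S t (S t)) \<le> h (S t))"
    unfolding death_time_def less_Inf_enat_iff by (simp add: not_less)
  also have "\<dots> \<longleftrightarrow> (\<forall>t\<le>K. enat (local_time S K (S t)) \<le> h (S t))"
  proof (intro iffI allI impI)
    fix t assume *: "\<forall>t\<le>K. enat (local_time S t (S t)) \<le> h (S t)" "t \<le> K"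
    define s where "s = Max {s. s \<le> K \<and> S s = S t}"
    have "s \<in> {s. s \<le> K \<and> S s = S t}" unfolding s_def using *(2) by (intro Max_in) auto
    then have s: "s \<le> K" "S s = S t" by auto
    have "S i \<noteq> S t" if "i \<in> {0..K} - {0..s}" for i
    proof
      assume "S i = S t"
      then have "i \<le> s" unfolding s_def using that by (intro Max_ge) auto
      then show False using that by simp
    qed
    then have "local_time S K (S t) = local_time S s (S t)" unfolding local_time_def
      using s by (intro sum.mono_neutral_right) auto
    then show "enat (local_time S K (S t)) \<le> h (S t)" using * s by metis
  next
    fix t assume *: "\<forall>t\<le>K. enat (local_time S K (S t)) \<le> h (S t)" "t \<le> K"
    then show "enat (local_time S t (S t)) \<le> h (S t)"
      using local_time_mono[of t K S "S t"] by (meson enat_ord_simps(1) order_trans)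
  qed
  also have "\<dots> \<longleftrightarrow> (\<forall>x\<in>S ` {..K}. enat (local_time S K x) \<le> h x)" by auto
  also have "S ` {..K} = set (map S [0..<Suc K])"
    by (simp add: atLeast0AtMost atLeastLessThanSuc_atLeastAtMost del: upt_Suc)
  finally show ?thesis by (simp only: local_time_eq_count)
qed

lemma mem_levels_map_iff:
  "k \<in> levels (map S [0..<Suc K]) \<longleftrightarrow>
     (\<exists>j\<le>K. S j $ 1 = int k \<and> (\<forall>t<j. S t $ 1 < int k) \<and> (\<forall>t. j < t \<and> t \<le> K \<longrightarrow> int k \<le> S t $ 1))"
proof
  assume "k \<in> levels (map S [0..<Suc K])"
  then obtain u x v where *: "map S [0..<Suc K] = u @ x # v" "x $ 1 = int k" "\<forall>y\<in>set u. y $ 1 < int k"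
    "\<forall>y\<in>set v. int k \<le> y $ 1" unfolding levels_def by blast
  have len: "Suc K = length u + Suc (length v)" using arg_cong[OF *(1), of length] by simp
  have nth: "S i = (u @ x # v) ! i" if "i \<le> K" for i using that
    by (simp add: *(1)[symmetric] del: upt_Suc)
  show "\<exists>j\<le>K. S j $ 1 = int k \<and> (\<forall>t<j. S t $ 1 < int k) \<and> (\<forall>t. j < t \<and> t \<le> K \<longrightarrow> int k \<le> S t $ 1)"
    using *(2-4) len
    by (intro exI[of _ "length u"]) (auto simp: nth nth_append nth_Cons')
next
  assume "\<exists>j\<le>K. S j $ 1 = int k \<and> (\<forall>t<j. S t $ 1 < int k) \<and> (\<forall>t. j < t \<and> t \<le> K \<longrightarrow> int k \<le> S t $ 1)"
  then obtain j where j: "j \<le> K" "S j $ 1 = int k" "\<forall>t<j. S t $ 1 < int k"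
    "\<forall>t. j < t \<and> t \<le> K \<longrightarrow> int k \<le> S t $ 1" by blast
  have "[0..<Suc K] = [0..<j] @ [j..<Suc K]" using j(1) using upt_add_eq_append[of 0 j "Suc K - j"] by (simp del: upt_Suc)
  also have "[j..<Suc K] = j # [Suc j..<Suc K]" using j(1) by (simp add: upt_conv_Cons del: upt_Suc)
  finally show "k \<in> levels (map S [0..<Suc K])" unfolding levels_def
    using j by (intro CollectI exI[of _ "map S [0..<j]"] exI[of _ "S j"] exI[of _ "map S [Suc j..<Suc K]"])
      (auto simp del: upt_Suc)
qed

text \<open>The infimum in \<open>separating_level\<close> leaves out the time alpha(n), while
  \<open>levels\<close> includes the endpoint; the endpoint has height at least n and thus never
  violates the bound. The restriction to \<open>{..n}\<close> is there because a general S may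
  overshoot n.\<close>

lemma separating_levels_eq:
  assumes K: "alpha S n = enat K"
  shows "{k. separating_level S n k} = levels (map S [0..<Suc K]) \<inter> {..n}"
proof -
  have "separating_level S n k \<longleftrightarrow> k \<in> levels (map S [0..<Suc K])" if "k \<le> n" for k
  proof -
    define j where "j = (LEAST t. int k \<le> S t $ 1)"
    have SK: "int k \<le> S K $ 1" using K that by (simp add: alpha_eq_iff)
    then have Sj: "int k \<le> S j $ 1" unfolding j_def by (rule LeastI)
    have jK: "j \<le> K" unfolding j_def using SK by (rule Least_le)
    have lj: "S t $ 1 < int k" if "t < j" for t using not_less_Least[of t "\<lambda>t. int k \<le> S t $ 1"] that
      unfolding j_def by simp
    have ak: "alpha S k = enat j" using Sj lj by (simp add: alpha_eq_iff)
    \<comment> \<open>Heights are integers, so the bound k - 1 keeps the supremum strictly below k;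
      it also covers the empty set of times.\<close>
    have "(SUP t\<in>{t. enat t < alpha S k}. ereal (real_of_int (S t $ 1))) \<le> ereal (real k - 1)"
      using lj unfolding ak by (intro SUP_least) fastforce
    also have "\<dots> < ereal (real k)" by simp
    finally have 1: "(SUP t\<in>{t. enat t < alpha S k}. ereal (real_of_int (S t $ 1))) < ereal (real k)" .
    have 2: "ereal (real k) \<le> (INF t\<in>{t. alpha S k < enat t \<and> enat t < alpha S n}. ereal (real_of_int (S t $ 1)))
      \<longleftrightarrow> (\<forall>t. j < t \<and> t < K \<longrightarrow> int k \<le> S t $ 1)"
      unfolding ak K by (auto simp: le_INF_iff)
    have "separating_level S n k \<longleftrightarrow> S j $ 1 = int k \<and> (\<forall>t. j < t \<and> t < K \<longrightarrow> int k \<le> S t $ 1)"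
      unfolding separating_level_def using 1 2 that K ak by simp
    also have "\<dots> \<longleftrightarrow> k \<in> levels (map S [0..<Suc K])"
      unfolding mem_levels_map_iff
    proof
      assume "S j $ 1 = int k \<and> (\<forall>t. j < t \<and> t < K \<longrightarrow> int k \<le> S t $ 1)"
      then show "\<exists>j\<le>K. S j $ 1 = int k \<and> (\<forall>t<j. S t $ 1 < int k) \<and> (\<forall>t. j < t \<and> t \<le> K \<longrightarrow> int k \<le> S t $ 1)"
        using jK lj SK by (intro exI[of _ j]) (metis le_neq_implies_less)
    next
      assume "\<exists>j\<le>K. S j $ 1 = int k \<and> (\<forall>t<j. S t $ 1 < int k) \<and> (\<forall>t. j < t \<and> t \<le> K \<longrightarrow> int k \<le> S t $ 1)"
      then obtain i where i: "i \<le> K" "S i $ 1 = int k" "\<forall>t<i. S t $ 1 < int k"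
        "\<forall>t. i < t \<and> t \<le> K \<longrightarrow> int k \<le> S t $ 1" by blast
      have "i = j" using i(2,3) lj Sj by (metis linorder_neqE_nat not_less order_refl)
      then show "S j $ 1 = int k \<and> (\<forall>t. j < t \<and> t < K \<longrightarrow> int k \<le> S t $ 1)" using i by auto
    qed
    finally show ?thesis .
  qed
  then show ?thesis by (auto simp: separating_level_def)
qed

section \<open>Events of the model as conditions on one finite path\<close>

lemma survives_to_iff: "alpha S n = enat K \<Longrightarrow> survives_to S h n \<longleftrightarrow> enat K < death_time S h"
  by (simp add: survives_to_def)

text \<open>Without survival \<open>eta\<close> is -1, which is not of the form
  \<open>int m\<close>, so the equation contains survival.\<close>

lemma eta_eq_iff:
  assumes "alpha S n = enat K" 
  shows "eta S h n = int m \<longleftrightarrow> enat K < death_time S h \<and> card (levels (map S [0..<Suc K]) \<inter> {..n}) = Suc m"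
  unfolding eta_def survives_to_iff[OF assms] separating_levels_eq[OF assms] by auto

lemma kappa_eq_0_iff:
  assumes "alpha S n = enat K" 
  defines "L \<equiv> levels (map S [0..<Suc K]) \<inter> {..n}"
  shows "kappa S h n = 0 \<longleftrightarrow> enat K < death_time S h \<and> 2 \<le> card L \<and> Max (L - {n}) = 0"
proof -
  have L: "separating_level S n k \<longleftrightarrow> k \<in> L" for k using separating_levels_eq[OF assms(1)] unfolding L_def by auto
  have "{k. separating_level S n k \<and> k < n} = L - {n}" unfolding L unfolding L_def by auto
  moreover have "eta S h n \<ge> 1 \<longleftrightarrow> enat K < death_time S h \<and> 2 \<le> card L"
    unfolding eta_def survives_to_iff[OF assms(1)] L by auto
  ultimately show ?thesis unfolding kappa_def by (auto simp: zero_ereal_def)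
qed

text \<open>Prescribing the path separates a condition on p alone, free of randomness, from the
  event that the trajectory begins with p. The event descriptions below all have this shape.\<close>

lemma alpha_initial_path_iff:
  "alpha S n < \<infinity> \<and> initial_path S (alpha S n) = p \<longleftrightarrow>
     first_passage n p \<and> map S [0..<length p] = p"
proof
  assume "alpha S n < \<infinity> \<and> initial_path S (alpha S n) = p"
  then obtain K where "alpha S n = enat K" "map S [0..<Suc K] = p" 
    by (cases "alpha S n") (auto simp: initial_path_def)
  then show "first_passage n p \<and> map S [0..<length p] = p"
    using alpha_eq_iff_first_passage[of S n K] by (auto simp del: upt_Suc)
next
  assume *: "first_passage n p \<and> map S [0..<length p] = p"
  then have "length p = Suc (length p - 1)" by (cases p) (auto simp: first_passage_def)
  then have "alpha S n = enat (length p - 1)" using * alpha_eq_iff_first_passage[of S n "length p - 1"] by simp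
  then show "alpha S n < \<infinity> \<and> initial_path S (alpha S n) = p"
    using * \<open>length p = _\<close> by (simp add: initial_path_def)
qed

lemma survives_event_iff:
  "alpha S n < death_time S h \<and> initial_path S (alpha S n) = p \<longleftrightarrow>
     first_passage n p \<and> map S [0..<length p] = p \<and> (\<forall>x\<in>set p. enat (count_list p x) \<le> h x)"
  (is "?L \<longleftrightarrow> ?R")
proof -
  have "?L \<longleftrightarrow> (alpha S n < \<infinity> \<and> initial_path S (alpha S n) = p) \<and> alpha S n < death_time S h"
    by (metis enat_ord_simps(6) enat_ord_simps(4))
  also have "\<dots> \<longleftrightarrow> (first_passage n p \<and> map S [0..<length p] = p) \<and> alpha S n < death_time S h"
    unfolding alpha_initial_path_iff ..
  also have "\<dots> \<longleftrightarrow> ?R"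
  proof (rule conj_cong[THEN trans, OF refl])
    assume *: "first_passage n p \<and> map S [0..<length p] = p"
    then obtain K where K: "length p = Suc K" by (cases p) (auto simp: first_passage_def)
    with * have p: "map S [0..<Suc K] = p" and a: "alpha S n = enat K"
      by (auto simp: alpha_eq_iff_first_passage simp del: upt_Suc)
    show "alpha S n < death_time S h \<longleftrightarrow> (\<forall>x\<in>set p. enat (count_list p x) \<le> h x)"
      unfolding a less_death_time_iff p ..
  qed blast
  finally show ?thesis .
qed

lemma eta_event_iff:
  "alpha S n < death_time S h \<and> eta S h n = int m \<and> initial_path S (alpha S n) = p \<longleftrightarrow>
     (first_passage n p \<and> card (levels p \<inter> {..n}) = Suc m) \<and>
     map S [0..<length p] = p \<and> (\<forall>x\<in>set p. enat (count_list p x) \<le> h x)"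
proof -
  have "eta S h n = int m \<longleftrightarrow> card (levels p \<inter> {..n}) = Suc m"
    if *: "alpha S n < death_time S h" "initial_path S (alpha S n) = p"
  proof -
    obtain K where a: "alpha S n = enat K" using *(1) by (cases "alpha S n") auto
    with *(2) have p: "map S [0..<Suc K] = p" by (simp add: initial_path_def)
    show ?thesis using *(1) unfolding eta_eq_iff[OF a] p by (simp add: a)
  qed
  then show ?thesis using survives_event_iff[of S n h p] by blast
qed

lemma kappa_event_iff:
  assumes "S 0 = 0"
  shows "alpha S n < \<infinity> \<and> kappa S h n = 0 \<and> initial_path S (alpha S n) = p \<longleftrightarrow>
     (first_passage n p \<and> 2 \<le> card (levels p \<inter> {..n}) \<and> Max (levels p \<inter> {..n} - {n}) = 0) \<and>
     map S [0..<length p] = p \<and> (\<forall>x\<in>set p. enat (count_list p x) \<le> h x)"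
  (is "?L \<longleftrightarrow> ?R")
proof -
  have "?L \<longleftrightarrow> (alpha S n < \<infinity> \<and> initial_path S (alpha S n) = p) \<and> kappa S h n = 0" by blast
  also have "\<dots> \<longleftrightarrow> (first_passage n p \<and> map S [0..<length p] = p) \<and> kappa S h n = 0"
    unfolding alpha_initial_path_iff ..
  also have "\<dots> \<longleftrightarrow> ?R"
  proof (rule conj_cong[THEN trans, OF refl])
    assume *: "first_passage n p \<and> map S [0..<length p] = p"
    then obtain K where K: "length p = Suc K" by (cases p) (auto simp: first_passage_def)
    with * have p: "map S [0..<Suc K] = p" and a: "alpha S n = enat K"
      by (auto simp: alpha_eq_iff_first_passage simp del: upt_Suc)
    show "kappa S h n = 0 \<longleftrightarrow> ((2 \<le> card (levels p \<inter> {..n}) \<and> Max (levels p \<inter> {..n} - {n}) = 0) \<and>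
     (\<forall>x\<in>set p. enat (count_list p x) \<le> h x))"
      unfolding kappa_eq_0_iff[OF a] p less_death_time_iff by blast
  qed blast
  finally show ?thesis .
qed

text \<open>The value 0 already implies survival. Spelling it out gives the event the form for which
  path probabilities are computed.\<close>

lemma eta_eq_0_iff: "eta S h k = 0 \<longleftrightarrow> alpha S k < death_time S h \<and> eta S h k = int 0"
  by (auto simp: eta_def survives_to_def)

lemma kappa_eq_0_iff_finite: "kappa S h k = 0 \<longleftrightarrow> alpha S k < \<infinity> \<and> kappa S h k = 0"
proof -
  have "alpha S k < \<infinity>" if "kappa S h k = 0"
  proof -
    have "survives_to S h k" using that by (auto simp: kappa_def eta_def split: if_splits)
    then show ?thesis unfolding survives_to_def by (rule less_le_trans) simp
  qed
  then show ?thesis by blast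
qed

text \<open>The duration of a block is no extra information: it is determined by the length of the
  list of points.\<close>

lemma eta_block_iff:
  assumes "length ys = K + 1"
  shows "alpha S k = enat K \<and> enat K < death_time S h \<and> eta S h k = 0 \<and> map S [0..<K + 1] = ys \<longleftrightarrow>
    alpha S k < death_time S h \<and> eta S h k = int 0 \<and> initial_path S (alpha S k) = ys" (is "?L \<longleftrightarrow> ?R")
proof
  assume ?R
  then obtain L where "alpha S k = enat L" by (cases "alpha S k") auto
  moreover have "L = K" using \<open>?R\<close> assms calculation by (auto simp: initial_path_def)
  ultimately show ?L using \<open>?R\<close> by (simp add: initial_path_def)
qed (simp add: initial_path_def)

lemma kappa_block_iff:
  assumes "S 0 = 0" "length xs = L"
  shows "alpha S l = enat L \<and> enat L < death_time S h \<and> kappa S h l = 0 \<and>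
      map (\<lambda>t. S t - S 0) [1..<L + 1] = xs \<longleftrightarrow>
    alpha S l < \<infinity> \<and> kappa S h l = 0 \<and> initial_path S (alpha S l) = 0 # xs" (is "?L \<longleftrightarrow> ?R")
proof -
  have map: "map S [0..<K + 1] = 0 # map (\<lambda>t. S t - S 0) [1..<K + 1]" for K
    using assms(1) by (simp add: upt_conv_Cons del: upt_Suc)
  show ?thesis
  proof
    assume ?R
    then obtain K where K: "alpha S l = enat K" by (cases "alpha S l") auto
    with \<open>?R\<close> map[of K] have xs: "map (\<lambda>t. S t - S 0) [1..<K + 1] = xs" by (simp add: initial_path_def)
    with assms(2) have "K = L" by auto
    then show ?L using \<open>?R\<close> K xs kappa_eq_0_iff[OF K] by simp
  qed (use map[of L] in \<open>auto simp: initial_path_def\<close>)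
qed

section \<open>Path probabilities of the walk\<close>

text \<open>Both events split into countably many disjoint pieces, one for each value in A, so an
  identity for single values is enough. Measurability is likewise only required for single
  values.\<close>

lemma prob_countable_transfer:
  fixes X :: "'w \<Rightarrow> 'c::countable" and Y :: "'v \<Rightarrow> 'c"
  assumes "prob_space M" "prob_space N" "0 \<le> c"
    and M: "\<And>x. {\<omega>\<in>space M. P \<omega> \<and> X \<omega> = x} \<in> sets M"
    and N: "\<And>x. {v\<in>space N. Q v \<and> Y v = x} \<in> sets N"
    and eq: "\<And>x. x \<in> A \<Longrightarrow> \<P>(\<omega> in M. P \<omega> \<and> X \<omega> = x) = c * \<P>(v in N. Q v \<and> Y v = x)"
  shows "\<P>(\<omega> in M. P \<omega> \<and> X \<omega> \<in> A) = c * \<P>(v in N. Q v \<and> Y v \<in> A)"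
proof -
  interpret M: prob_space M by fact
  interpret N: prob_space N by fact
  have "emeasure M {\<omega>\<in>space M. P \<omega> \<and> X \<omega> \<in> A} = emeasure M (\<Union>x\<in>A. {\<omega>\<in>space M. P \<omega> \<and> X \<omega> = x})"
    by (rule arg_cong[where f = "emeasure M"]) auto
  also have "\<dots> = (\<integral>\<^sup>+x. emeasure M {\<omega>\<in>space M. P \<omega> \<and> X \<omega> = x} \<partial>count_space A)"
    by (rule emeasure_UN_countable) (auto simp: disjoint_family_on_def M)
  also have "\<dots> = (\<integral>\<^sup>+x. ennreal c * emeasure N {v\<in>space N. Q v \<and> Y v = x} \<partial>count_space A)"
    using eq \<open>0 \<le> c\<close>
    by (intro nn_integral_cong) (simp add: M.emeasure_eq_measure N.emeasure_eq_measure ennreal_mult)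
  also have "\<dots> = ennreal c * (\<integral>\<^sup>+x. emeasure N {v\<in>space N. Q v \<and> Y v = x} \<partial>count_space A)"
    by (rule nn_integral_cmult) simp
  also have "(\<integral>\<^sup>+x. emeasure N {v\<in>space N. Q v \<and> Y v = x} \<partial>count_space A) =
      emeasure N (\<Union>x\<in>A. {v\<in>space N. Q v \<and> Y v = x})"
    by (rule emeasure_UN_countable[symmetric]) (auto simp: disjoint_family_on_def N)
  also have "(\<Union>x\<in>A. {v\<in>space N. Q v \<and> Y v = x}) = {v\<in>space N. Q v \<and> Y v \<in> A}" by auto
  finally show ?thesis using \<open>0 \<le> c\<close>
    by (simp add: M.emeasure_eq_measure N.emeasure_eq_measure ennreal_mult[symmetric])
qed

lemma map_eq_in_sets:
  assumes X: "\<And>t. X t \<in> measurable M (count_space UNIV)"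
  shows "{\<omega>\<in>space M. map (\<lambda>t. X t \<omega>) [0..<length p] = p} \<in> sets M"
proof -
  have *: "map (\<lambda>t. X t \<omega>) [0..<length p] = p \<longleftrightarrow> (\<forall>i\<in>{..<length p}. X i \<omega> = p ! i)" for \<omega>
    by (subst list_eq_iff_nth_eq) auto
  have "{\<omega>\<in>space M. X i \<omega> = y} \<in> sets M" for i y
    using measurable_sets[OF X, of "{y}" i] by (simp add: vimage_def Int_def conj_commute)
  then show ?thesis unfolding * by (intro sets.sets_Collect_finite_All) auto
qed

text \<open>For a fixed p only finitely many times and sites matter; C stands for the condition on p
  alone.\<close>

lemma path_event_in_sets:
  assumes X: "\<And>t. X t \<in> measurable M (count_space UNIV)"
    and h: "\<And>x. h x \<in> measurable M (count_space UNIV)"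
  shows "{\<omega>\<in>space M. C \<and> map (\<lambda>t. X t \<omega>) [0..<length p] = p \<and> (\<forall>x\<in>set p. c x \<le> h x \<omega>)} \<in> sets M"
proof -
  have "{\<omega>\<in>space M. c x \<le> h x \<omega>} \<in> sets M" for x
    using measurable_sets[OF h, of "{c x..}" x] by (simp add: vimage_def Int_def conj_commute)
  then show ?thesis
    by (intro sets.sets_Collect_conj sets.sets_Collect_const sets.sets_Collect_finite_All map_eq_in_sets[OF X]) auto
qed

lemma walk_0: "walk S0 \<xi> \<omega> 0 = S0 \<omega>"
  by (simp add: walk_def)

lemma walk_Suc: "walk S0 \<xi> \<omega> (Suc t) = walk S0 \<xi> \<omega> t + \<xi> (Suc t) \<omega>"
  by (simp add: walk_def add.assoc)

lemma walk_path_iff: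
  assumes "p \<noteq> []"
  shows "map (walk S0 \<xi> \<omega>) [0..<length p] = p \<longleftrightarrow>
     S0 \<omega> = hd p \<and> (\<forall>i<length p - 1. \<xi> (Suc i) \<omega> = p ! Suc i - p ! i)"
proof
  assume "map (walk S0 \<xi> \<omega>) [0..<length p] = p"
  then have *: "walk S0 \<xi> \<omega> i = p ! i" if "i < length p" for i
    using that by (metis add_0 diff_zero length_upt nth_map nth_upt)
  have "\<xi> (Suc i) \<omega> = p ! Suc i - p ! i" if "i < length p - 1" for i
    using *[of i] *[of "Suc i"] that by (simp add: walk_Suc eq_diff_eq add.commute)
  moreover have "S0 \<omega> = hd p" using *[of 0] assms by (simp add: walk_0 hd_conv_nth)
  ultimately show "S0 \<omega> = hd p \<and> (\<forall>i<length p - 1. \<xi> (Suc i) \<omega> = p ! Suc i - p ! i)" by blast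
next
  assume *: "S0 \<omega> = hd p \<and> (\<forall>i<length p - 1. \<xi> (Suc i) \<omega> = p ! Suc i - p ! i)"
  have "walk S0 \<xi> \<omega> i = p ! i" if "i < length p" for i
    using that
  proof (induction i)
    case 0
    then show ?case using * assms by (simp add: walk_0 hd_conv_nth)
  next
    case (Suc i)
    then show ?case using * by (simp add: walk_Suc)
  qed
  then show "map (walk S0 \<xi> \<omega>) [0..<length p] = p" by (intro nth_equalityI) auto
qed

text \<open>A non-zero product has no zero factor, so each single step has positive probability.
  Consequently, restricting attention to skip-free paths loses no mass.\<close>

lemma successively_of_step_weight:
  fixes p :: "'d::{finite, one} lattice list"
  assumes "\<And>v. a v \<noteq> 0 \<Longrightarrow> v $ 1 \<le> 1"
  shows "step_weight a p \<noteq> 0 \<Longrightarrow> successively (\<lambda>x y. y $ 1 \<le> x $ 1 + 1) p"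
proof (induction p rule: induct_list012)
  case (3 x y zs)
  then show ?case using assms[of "y - x"] by simp
qed auto

section \<open>Path probabilities as products, by independence\<close>

context constrained_walk
begin

definition step_prob :: "'d lattice \<Rightarrow> real" where
  "step_prob v = \<P>(\<omega> in M. \<xi> 1 \<omega> = v)"

definition site_prob :: "nat \<Rightarrow> real" where
  "site_prob c = \<P>(\<omega> in M. enat c \<le> H 0 \<omega>)"

text \<open>This stays one joint probability, since (A2) allows the start and the constraints
  outside the upper half space to depend on each other.\<close>

definition start_prob :: "'d lattice list \<Rightarrow> real" where
  "start_prob p = \<P>(\<omega> in M. S0 \<omega> = hd p \<and> (\<forall>x\<in>set p - upper_half. enat (count_list p x) \<le> H x \<omega>))"

definition path_weight :: "'d lattice list \<Rightarrow> real" where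
  "path_weight p = start_prob p * step_weight step_prob p * site_weight site_prob p"

definition block_weight :: "'d lattice list \<Rightarrow> real" where
  "block_weight xs = step_weight step_prob (0 # xs) * site_weight site_prob (0 # xs)"

declare S0_measurable [measurable] H_measurable [measurable]

lemma xi_Suc_measurable [measurable]: "\<xi> (Suc i) \<in> measurable M (count_space UNIV)"
  by (simp add: xi_measurable)

lemma walk_measurable [measurable]:
  assumes [measurable]: "T \<in> measurable M (count_space UNIV)"
  shows "(\<lambda>\<omega>. walk T \<xi> \<omega> t) \<in> measurable M (count_space UNIV)"
proof (induction t)
  case (Suc t)
  note Suc [measurable]
  show ?case unfolding walk_Suc by measurable
qed (simp add: walk_0)

lemma generated_events_subset: "generated_events M X I \<subseteq> Pow (space M)"
proof -
  have "{X i -` A \<inter> space M |i A. i \<in> I} \<subseteq> Pow (space M)" by blast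
  then show ?thesis unfolding generated_events_def using sigma_sets_into_sp by blast
qed

lemma H_event_in_generated:
  "x \<in> I \<Longrightarrow> {\<omega>\<in>space M. enat c \<le> H x \<omega>} \<in> generated_events M H I"
  unfolding generated_events_def by (rule sigma_sets.Basic) (auto intro!: exI[of _ x] exI[of _ "{enat c..}"])

lemma prob_step:
  assumes "1 \<le> i"
  shows "prob (\<xi> i -` {v} \<inter> space M) = step_prob v"
proof -
  have "prob (\<xi> i -` {v} \<inter> space M) = measure (distr M (count_space UNIV) (\<xi> i)) {v}"
    using xi_measurable[OF assms] by (simp add: measure_distr)
  also have "\<dots> = measure (distr M (count_space UNIV) (\<xi> 1)) {v}" using A1_ident[OF assms] by simp
  also have "\<dots> = prob (\<xi> 1 -` {v} \<inter> space M)" using xi_measurable[of 1] by (simp add: measure_distr)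
  also have "\<xi> 1 -` {v} \<inter> space M = {\<omega>\<in>space M. \<xi> 1 \<omega> = v}" by auto
  finally show ?thesis by (simp add: step_prob_def)
qed

lemma prob_site:
  assumes "x \<in> upper_half"
  shows "prob (H x -` {enat c..} \<inter> space M) = site_prob c"
proof -
  have "prob (H x -` {enat c..} \<inter> space M) = measure (distr M (count_space UNIV) (H x)) {enat c..}"
    by (simp add: measure_distr H_measurable)
  also have "\<dots> = measure (distr M (count_space UNIV) (H 0)) {enat c..}" using A3_ident[OF assms] by simp
  also have "\<dots> = prob (H 0 -` {enat c..} \<inter> space M)" by (simp add: measure_distr H_measurable)
  also have "H 0 -` {enat c..} \<inter> space M = {\<omega>\<in>space M. enat c \<le> H 0 \<omega>}" by auto
  finally show ?thesis by (simp add: site_prob_def)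
qed

lemma prob_steps: "\<P>(\<omega> in M. \<forall>i<K. \<xi> (Suc i) \<omega> = d i) = (\<Prod>i<K. step_prob (d i))"
proof (cases "K = 0")
  case False
  have "{\<omega>\<in>space M. \<forall>i<K. \<xi> (Suc i) \<omega> = d i} = (\<Inter>j\<in>{1..K}. \<xi> j -` {d (j - 1)} \<inter> space M)"
  proof (intro set_eqI iffI)
    fix \<omega> assume *: "\<omega> \<in> (\<Inter>j\<in>{1..K}. \<xi> j -` {d (j - 1)} \<inter> space M)"
    have "1 \<in> {1..K}" using False by simp
    with * have "\<omega> \<in> space M" by blast
    moreover have "\<xi> (Suc i) \<omega> = d i" if "i < K" for i
    proof -
      have "Suc i \<in> {1..K}" using that by simp
      with * have "\<omega> \<in> \<xi> (Suc i) -` {d (Suc i - 1)}" by blast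
      then show ?thesis by simp
    qed
    ultimately show "\<omega> \<in> {\<omega>\<in>space M. \<forall>i<K. \<xi> (Suc i) \<omega> = d i}" by simp
  next
    fix \<omega> assume *: "\<omega> \<in> {\<omega>\<in>space M. \<forall>i<K. \<xi> (Suc i) \<omega> = d i}"
    have "\<xi> j \<omega> = d (j - 1)" if "j \<in> {1..K}" for j using that * by (cases j) auto
    with * show "\<omega> \<in> (\<Inter>j\<in>{1..K}. \<xi> j -` {d (j - 1)} \<inter> space M)" by blast
  qed
  also have "prob \<dots> = (\<Prod>j\<in>{1..K}. prob (\<xi> j -` {d (j - 1)} \<inter> space M))"
    using False by (intro indep_varsD[OF A1_indep]) auto
  also have "\<dots> = (\<Prod>j\<in>{1..K}. step_prob (d (j - 1)))" by (intro prod.cong prob_step) auto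
  also have "\<dots> = (\<Prod>i<K. step_prob (d i))" by (simp add: prod.atLeast1_atMost_eq)
  finally show ?thesis .
qed (simp add: prob_space)

lemma prob_sites:
  assumes "finite X" "X \<subseteq> upper_half"
  shows "\<P>(\<omega> in M. \<forall>x\<in>X. enat (c x) \<le> H x \<omega>) = (\<Prod>x\<in>X. site_prob (c x))"
proof (cases "X = {}")
  case False
  then have "{\<omega>\<in>space M. \<forall>x\<in>X. enat (c x) \<le> H x \<omega>} = (\<Inter>x\<in>X. H x -` {enat (c x)..} \<inter> space M)"
    by auto
  also have "prob \<dots> = (\<Prod>x\<in>X. prob (H x -` {enat (c x)..} \<inter> space M))"
    using False assms by (intro indep_varsD[OF A3_indep]) auto
  also have "\<dots> = (\<Prod>x\<in>X. site_prob (c x))" using assms by (intro prod.cong prob_site) auto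
  finally show ?thesis .
qed (simp add: prob_space)

text \<open>The event E is left general so that both models are covered: for P_* it describes the
  start and the lower constraints, for P_0 it is the whole space because these data are
  deterministic.\<close>

lemma prob_start_steps_sites:
  assumes E: "E \<in> sigma_sets (space M)
      (generated_events M (\<lambda>_::unit. S0) UNIV \<union> generated_events M H (- upper_half))"
    and X: "finite X" "X \<subseteq> upper_half"
  shows "prob (E \<inter> {\<omega>\<in>space M. \<forall>i<K. \<xi> (Suc i) \<omega> = d i} \<inter> {\<omega>\<in>space M. \<forall>x\<in>X. enat (c x) \<le> H x \<omega>}) =
    prob E * (\<Prod>i<K. step_prob (d i)) * (\<Prod>x\<in>X. site_prob (c x))"
proof -
  define F where "F = {\<omega>\<in>space M. \<forall>i<K. \<xi> (Suc i) \<omega> = d i}"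
  define G where "G = {\<omega>\<in>space M. \<forall>x\<in>X. enat (c x) \<le> H x \<omega>}"
  have F: "F \<in> generated_events M \<xi> {1..}"
  proof -
    interpret sigma_algebra "space M" "generated_events M \<xi> {1..}"
      unfolding generated_events_def by (rule sigma_algebra_sigma_sets) auto
    have "{\<omega>\<in>space M. \<xi> (Suc i) \<omega> = d i} \<in> generated_events M \<xi> {1..}" for i
      unfolding generated_events_def
      by (rule sigma_sets.Basic) (auto intro!: exI[of _ "Suc i"] exI[of _ "{d i}"])
    then have "{\<omega>\<in>space M. \<forall>i\<in>{..<K}. \<xi> (Suc i) \<omega> = d i} \<in> generated_events M \<xi> {1..}"
      by (intro sets_Collect_finite_All) auto
    then show ?thesis unfolding F_def by (simp only: lessThan_iff Ball_def)
  qed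
  have G: "G \<in> generated_events M H upper_half"
  proof -
    interpret sigma_algebra "space M" "generated_events M H upper_half"
      unfolding generated_events_def by (rule sigma_algebra_sigma_sets) auto
    show ?thesis unfolding G_def using X by (intro sets_Collect_finite_All H_event_in_generated) auto
  qed
  have three: "{..<3} = {0, 1, 2::nat}" by auto
  have "prob (\<Inter>j\<in>{..<3}. [E, F, G] ! j) = (\<Prod>j\<in>{..<3}. prob ([E, F, G] ! j))"
    using E F G by (intro indep_setsD[OF A2_indep]) (auto simp: three)
  then have "prob (E \<inter> F \<inter> G) = prob E * prob F * prob G"
    by (simp add: three Int_assoc mult.assoc)
  then show ?thesis unfolding F_def G_def prob_steps prob_sites[OF X] .
qed

lemma prob_walk_path:
  assumes "p \<noteq> []"
  shows "\<P>(\<omega> in M. map (walk S0 \<xi> \<omega>) [0..<length p] = p \<and> (\<forall>x\<in>set p. enat (count_list p x) \<le> H x \<omega>)) =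
    path_weight p"
proof -
  define E where "E = {\<omega>\<in>space M. S0 \<omega> = hd p \<and> (\<forall>x\<in>set p - upper_half. enat (count_list p x) \<le> H x \<omega>)}"
  let ?G = "generated_events M (\<lambda>_::unit. S0) UNIV \<union> generated_events M H (- upper_half)"
  have "E \<in> sigma_sets (space M) ?G"
  proof -
    have "?G \<subseteq> Pow (space M)" by (intro Un_least generated_events_subset)
    then interpret sigma_algebra "space M" "sigma_sets (space M) ?G"
      by (rule sigma_algebra_sigma_sets)
    have "{\<omega>\<in>space M. S0 \<omega> = hd p} \<in> generated_events M (\<lambda>_::unit. S0) UNIV"
      unfolding generated_events_def
      by (rule sigma_sets.Basic) (auto intro!: exI[of _ "{hd p}"])
    then have 1: "{\<omega>\<in>space M. S0 \<omega> = hd p} \<in> sigma_sets (space M) ?G" by (intro sigma_sets.Basic) simp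
    have 2: "{\<omega>\<in>space M. \<forall>x\<in>set p - upper_half. enat (count_list p x) \<le> H x \<omega>} \<in> sigma_sets (space M) ?G"
      using H_event_in_generated[of _ "- upper_half"]
      by (intro sets_Collect_finite_All sigma_sets.Basic) auto
    show ?thesis unfolding E_def using sets_Collect_conj[OF 2 1] .
  qed
  note * = prob_start_steps_sites[OF this, of "set p \<inter> upper_half" "length p - 1" "\<lambda>i. p ! Suc i - p ! i" "count_list p"]
  have "{\<omega>\<in>space M. map (walk S0 \<xi> \<omega>) [0..<length p] = p \<and> (\<forall>x\<in>set p. enat (count_list p x) \<le> H x \<omega>)} =
    E \<inter> {\<omega>\<in>space M. \<forall>i<length p - 1. \<xi> (Suc i) \<omega> = p ! Suc i - p ! i} \<inter>
    {\<omega>\<in>space M. \<forall>x\<in>set p \<inter> upper_half. enat (count_list p x) \<le> H x \<omega>}"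
    unfolding walk_path_iff[OF assms] E_def by blast
  then show ?thesis using * by (simp add: path_weight_def step_weight_eq_prod site_weight_def start_prob_def E_def)
qed

text \<open>A path that leaves the upper half space visits a site with constraint 0 at least once
  and is thereby excluded; for the remaining paths only steps and upper sites contribute.\<close>

lemma prob_walk0_path:
  assumes "p \<noteq> []" "hd p = 0"
  shows "\<P>(\<omega> in M. map (walk (\<lambda>_. 0) \<xi> \<omega>) [0..<length p] = p \<and>
       (\<forall>x\<in>set p. enat (count_list p x) \<le> half_constraint H \<omega> x)) =
    (if set p \<subseteq> upper_half then step_weight step_prob p * site_weight site_prob p else 0)"
proof (cases "set p \<subseteq> upper_half")
  case True
  have "space M \<in> sigma_sets (space M) (generated_events M (\<lambda>_::unit. S0) UNIV \<union> generated_events M H (- upper_half))"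
    by (rule sigma_sets_top)
  note * = prob_start_steps_sites[OF this, of "set p" "length p - 1" "\<lambda>i. p ! Suc i - p ! i" "count_list p"]
  have "{\<omega>\<in>space M. map (walk (\<lambda>_. 0) \<xi> \<omega>) [0..<length p] = p \<and>
       (\<forall>x\<in>set p. enat (count_list p x) \<le> half_constraint H \<omega> x)} =
    space M \<inter> {\<omega>\<in>space M. \<forall>i<length p - 1. \<xi> (Suc i) \<omega> = p ! Suc i - p ! i} \<inter>
    {\<omega>\<in>space M. \<forall>x\<in>set p. enat (count_list p x) \<le> H x \<omega>}"
    unfolding walk_path_iff[OF assms(1)] using assms(2) True by (auto simp: half_constraint_def subset_iff)
  moreover have "set p \<inter> upper_half = set p" using True by blast
  ultimately show ?thesis using * True by (simp add: step_weight_eq_prod site_weight_def prob_space)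
next
  case False
  then obtain x where x: "x \<in> set p" "x \<notin> upper_half" by blast
  then have "count_list p x \<noteq> 0" by (simp add: count_list_0_iff)
  then have "\<not> enat (count_list p x) \<le> half_constraint H \<omega> x" for \<omega>
    using x by (simp add: half_constraint_def zero_enat_def)
  with x have "{\<omega>\<in>space M. map (walk (\<lambda>_. 0) \<xi> \<omega>) [0..<length p] = p \<and>
       (\<forall>x\<in>set p. enat (count_list p x) \<le> half_constraint H \<omega> x)} = {}" by blast
  with False show ?thesis by (simp only: measure_empty if_False)
qed

lemma site_prob_1: "site_prob 1 = 1"
  using A3_ge by (simp add: site_prob_def one_enat_def)

lemma step_prob_nonzero: "step_prob v \<noteq> 0 \<Longrightarrow> v $ 1 \<le> 1"
proof (rule ccontr)
  assume *: "step_prob v \<noteq> 0" "\<not> v $ 1 \<le> 1"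
  have [measurable]: "\<xi> 1 \<in> measurable M (count_space UNIV)" by (simp add: xi_measurable)
  have "{\<omega>\<in>space M. \<xi> 1 \<omega> $ 1 \<le> 1} = \<xi> 1 -` {v. v $ 1 \<le> 1} \<inter> space M" by auto
  then have "{\<omega>\<in>space M. \<xi> 1 \<omega> $ 1 \<le> 1} \<in> events"
    using measurable_sets[OF xi_measurable[of 1], of "{v. v $ 1 \<le> 1}"] by simp
  with A1_le have "AE \<omega> in M. \<xi> 1 \<omega> $ 1 \<le> 1" by (simp only: prob_Collect_eq_1)
  then have "AE \<omega> in M. \<not> \<xi> 1 \<omega> = v" using *(2) by (auto elim!: eventually_mono)
  then have "step_prob v = 0" unfolding step_prob_def by (subst prob_Collect_eq_0) simp_all
  with *(1) show False by simp
qed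

lemma path_weight_nonzero:
  assumes "path_weight p \<noteq> 0" "p \<noteq> []"
  shows "skip_free p"
proof -
  have "hd p $ 1 \<le> 0"
  proof (rule ccontr)
    assume "\<not> hd p $ 1 \<le> 0"
    with A2_start have "AE \<omega> in M. \<not> (S0 \<omega> = hd p \<and> (\<forall>x\<in>set p - upper_half. enat (count_list p x) \<le> H x \<omega>))"
      by (auto elim!: eventually_mono)
    then have "start_prob p = 0" unfolding start_prob_def by (subst prob_Collect_eq_0) measurable
    with assms show False by (simp add: path_weight_def)
  qed
  moreover have "successively (\<lambda>x y. y $ 1 \<le> x $ 1 + 1) p"
    using assms step_prob_nonzero by (intro successively_of_step_weight[of step_prob]) (auto simp: path_weight_def)
  ultimately show ?thesis using assms by (simp add: skip_free_def)
qed

text \<open>The event does not mention skip-freeness, but a path without it has weight 0. For a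
  skip-free path no level exceeds n, so the restriction to \<open>{..n}\<close> disappears.\<close>

lemma prob_eta_path:
  "\<P>(\<omega> in M. alpha (walk S0 \<xi> \<omega>) n < death_time (walk S0 \<xi> \<omega>) (\<lambda>x. H x \<omega>) \<and>
      eta (walk S0 \<xi> \<omega>) (\<lambda>x. H x \<omega>) n = int m \<and>
      initial_path (walk S0 \<xi> \<omega>) (alpha (walk S0 \<xi> \<omega>) n) = p) =
   (if passage_path m n p then path_weight p else 0)"
proof (cases "first_passage n p \<and> card (levels p \<inter> {..n}) = Suc m")
  case True
  then have ne: "p \<noteq> []" by (auto simp: first_passage_def)
  have "passage_path m n p \<longleftrightarrow> skip_free p"
    using True passage_pathD(3)[of p n] by (auto simp: passage_path_def Int_absorb2)
  moreover have "path_weight p = 0" if "\<not> skip_free p" using path_weight_nonzero ne that by blast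
  ultimately show ?thesis unfolding eta_event_iff using True prob_walk_path[OF ne] by auto
next
  case False
  then have "\<not> passage_path m n p" using passage_pathD(3)[of p n] by (auto simp: passage_path_def Int_absorb2)
  with False show ?thesis unfolding eta_event_iff by auto
qed

lemma eta_path_measurable:
  "{\<omega>\<in>space M. alpha (walk S0 \<xi> \<omega>) n < death_time (walk S0 \<xi> \<omega>) (\<lambda>x. H x \<omega>) \<and>
      eta (walk S0 \<xi> \<omega>) (\<lambda>x. H x \<omega>) n = int m \<and>
      initial_path (walk S0 \<xi> \<omega>) (alpha (walk S0 \<xi> \<omega>) n) = p} \<in> sets M"
  unfolding eta_event_iff
  by (rule path_event_in_sets[OF walk_measurable[OF S0_measurable] H_measurable])

lemma survives_path_measurable:
  "{\<omega>\<in>space M. alpha (walk S0 \<xi> \<omega>) n < death_time (walk S0 \<xi> \<omega>) (\<lambda>x. H x \<omega>) \<and>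
      initial_path (walk S0 \<xi> \<omega>) (alpha (walk S0 \<xi> \<omega>) n) = p} \<in> sets M"
  unfolding survives_event_iff
  by (rule path_event_in_sets[OF walk_measurable[OF S0_measurable] H_measurable])

lemma block_path_iff:
  assumes "1 \<le> l" "skip_free (0 # xs)"
  shows "block_path l xs \<longleftrightarrow> first_passage l (0 # xs) \<and> 2 \<le> card (levels (0 # xs) \<inter> {..l}) \<and>
    Max (levels (0 # xs) \<inter> {..l} - {l}) = 0"
proof -
  let ?L = "levels (0 # xs)"
  have "?L = {0, l} \<longleftrightarrow> 2 \<le> card (?L \<inter> {..l}) \<and> Max (?L \<inter> {..l} - {l}) = 0" if "first_passage l (0 # xs)"
  proof
    assume *: "?L = {0, l}"
    have "{0, l} \<inter> {..l} = {0, l}" by auto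
    moreover have "{0, l} - {l} = {0}" using assms(1) by auto
    ultimately show "2 \<le> card (?L \<inter> {..l}) \<and> Max (?L \<inter> {..l} - {l}) = 0" unfolding * using assms(1) by simp
  next
    assume *: "2 \<le> card (?L \<inter> {..l}) \<and> Max (?L \<inter> {..l} - {l}) = 0"
    have L: "l \<in> ?L" "?L \<subseteq> {..l}" using passage_pathD[OF assms(2) that] by auto
    \<comment> \<open>\<open>Max\<close> of the empty set is unspecified, so the cardinality bound
      has to exclude this case first.\<close>
    have "?L - {l} \<noteq> {}"
    proof
      assume "?L - {l} = {}"
      then have "?L = {l}" using L by auto
      with * show False by simp
    qed
    then have "Max (?L - {l}) \<in> ?L - {l}" by (intro Max_in) (auto simp: finite_levels)
    moreover have z: "Max (?L - {l}) = 0" using * L by (simp add: Int_absorb2)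
    moreover have "x = 0" if "x \<in> ?L - {l}" for x
      using Max_ge[of "?L - {l}" x] that z by (simp add: finite_levels)
    ultimately show "?L = {0, l}" using L by auto
  qed
  then show ?thesis using assms by (auto simp: block_path_def)
qed

lemma prob_kappa_path:
  assumes "1 \<le> l"
  shows "\<P>(\<omega> in M. alpha (walk (\<lambda>_. 0) \<xi> \<omega>) l < \<infinity> \<and>
      kappa (walk (\<lambda>_. 0) \<xi> \<omega>) (half_constraint H \<omega>) l = 0 \<and>
      initial_path (walk (\<lambda>_. 0) \<xi> \<omega>) (alpha (walk (\<lambda>_. 0) \<xi> \<omega>) l) = 0 # xs) =
   (if block_path l xs then block_weight xs else 0)"
proof -
  let ?p = "0 # xs"
  let ?C = "first_passage l ?p \<and> 2 \<le> card (levels ?p \<inter> {..l}) \<and> Max (levels ?p \<inter> {..l} - {l}) = 0"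
  have "\<P>(\<omega> in M. ?C \<and> map (walk (\<lambda>_. 0) \<xi> \<omega>) [0..<length ?p] = ?p \<and>
       (\<forall>x\<in>set ?p. enat (count_list ?p x) \<le> half_constraint H \<omega> x)) = 
     (if block_path l xs then block_weight xs else 0)"
  proof (cases "skip_free ?p")
    case True
    have "set ?p \<subseteq> upper_half" if "block_path l xs"
      using that zero_mem_levels_Cons[of xs] by (auto simp: block_path_def upper_half_def)
    then show ?thesis 
      using block_path_iff[OF assms True] prob_walk0_path[of ?p] by (cases "block_path l xs") (auto simp: block_weight_def)
  next
    case False
    then have "\<not> successively (\<lambda>x y. y $ 1 \<le> x $ 1 + 1) ?p" by (simp add: skip_free_def)
    then have "step_weight step_prob ?p = 0"
      using successively_of_step_weight[of step_prob ?p] step_prob_nonzero by blast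
    then have "\<P>(\<omega> in M. map (walk (\<lambda>_. 0) \<xi> \<omega>) [0..<length ?p] = ?p \<and>
       (\<forall>x\<in>set ?p. enat (count_list ?p x) \<le> half_constraint H \<omega> x)) = 0"
      using prob_walk0_path[of ?p] by simp
    moreover have "\<not> block_path l xs" using False by (simp add: block_path_def)
    ultimately show ?thesis by (cases ?C) auto
  qed
  then show ?thesis by (subst kappa_event_iff) (simp_all add: walk_0)
qed

lemma kappa_path_measurable:
  "{\<omega>\<in>space M. alpha (walk (\<lambda>_. 0) \<xi> \<omega>) l < \<infinity> \<and>
      kappa (walk (\<lambda>_. 0) \<xi> \<omega>) (half_constraint H \<omega>) l = 0 \<and>
      initial_path (walk (\<lambda>_. 0) \<xi> \<omega>) (alpha (walk (\<lambda>_. 0) \<xi> \<omega>) l) = p} \<in> sets M"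
proof (subst kappa_event_iff)
  have "(\<lambda>\<omega>. half_constraint H \<omega> x) \<in> measurable M (count_space UNIV)" for x
    unfolding half_constraint_def by measurable
  then show "{\<omega>\<in>space M. (first_passage l p \<and> 2 \<le> card (levels p \<inter> {..l}) \<and> Max (levels p \<inter> {..l} - {l}) = 0) \<and>
      map (walk (\<lambda>_. 0) \<xi> \<omega>) [0..<length p] = p \<and>
      (\<forall>x\<in>set p. enat (count_list p x) \<le> half_constraint H \<omega> x)} \<in> events"
    by (intro path_event_in_sets walk_measurable) simp_all
qed (simp add: walk_0)

lemma path_weight_concat:
  assumes "passage_path m k (u @ [c])" "block_path l xs"
  shows "path_weight (u @ map ((+) c) (0 # xs)) = path_weight (u @ [c]) * block_weight xs"
proof -
  note W = weight_concat(1)[where g = site_prob and a = step_prob, OF assms site_prob_1]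
    weight_concat(2-)[where g = site_prob, OF assms site_prob_1]
  have h: "hd (u @ map ((+) c) (0 # xs)) = hd (u @ [c])" by (cases u) auto
  have "start_prob (u @ map ((+) c) (0 # xs)) = start_prob (u @ [c])"
    unfolding start_prob_def h W(4) using W(5) by (metis (mono_tags, lifting) DiffE)
  with W(1,2) show ?thesis by (simp add: path_weight_def block_weight_def)
qed

end

section \<open>Path probabilities of the core sequence\<close>

text \<open>The core trajectory up to the end of block m, built by gluing and thus suited to
  induction on m. It avoids the search for the block containing a given time, on which
  \<open>core_seq\<close> is based.\<close>

fun core_path :: "(nat \<Rightarrow> 'd::{finite, one} block) \<Rightarrow> nat \<Rightarrow> 'd lattice list" where
  "core_path \<beta> 0 = block_points (\<beta> 0)"
| "core_path \<beta> (Suc m) = core_path \<beta> m @ map ((+) (last (core_path \<beta> m))) (block_points (\<beta> (Suc m)))"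

text \<open>Together with \<open>step_block\<close> this singles out the triples that arise from
  cutting a path. The duration must agree with the list, since a triple could otherwise carry any
  number there.\<close>

definition initial_block :: "'d::{finite, one} block \<Rightarrow> bool" where
  "initial_block \<equiv> \<lambda>(k, K, ys). passage_path 0 k ys \<and> length ys = K + 1"

definition step_block :: "'d::{finite, one} block \<Rightarrow> bool" where
  "step_block \<equiv> \<lambda>(l, L, xs). block_path l xs \<and> length xs = L"

definition valid_blocks :: "(nat \<Rightarrow> 'd::{finite, one} block) \<Rightarrow> nat \<Rightarrow> bool" where
  "valid_blocks \<beta> m \<longleftrightarrow> initial_block (\<beta> 0) \<and> (\<forall>i\<in>{1..m}. step_block (\<beta> i))"

lemma valid_blocks_0: "valid_blocks \<beta> 0 \<longleftrightarrow> initial_block (\<beta> 0)"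
  by (simp add: valid_blocks_def)

lemma valid_blocks_Suc: "valid_blocks \<beta> (Suc m) \<longleftrightarrow> valid_blocks \<beta> m \<and> step_block (\<beta> (Suc m))"
  by (auto simp: valid_blocks_def atLeastAtMostSuc_conv)

lemma initial_block_iff:
  "initial_block b \<longleftrightarrow> passage_path 0 (block_height b) (block_points b) \<and>
     length (block_points b) = block_duration b + 1"
  by (cases b) (simp add: initial_block_def block_height_def block_points_def block_duration_def)

lemma step_block_iff:
  "step_block b \<longleftrightarrow> block_path (block_height b) (block_points b) \<and>
     length (block_points b) = block_duration b"
  by (cases b) (simp add: step_block_def block_height_def block_points_def block_duration_def)

lemma block_eqI:
  "block_height b = block_height c \<Longrightarrow> block_duration b = block_duration c \<Longrightarrow>
    block_points b = block_points c \<Longrightarrow> b = c"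
  by (cases b, cases c) (simp add: block_height_def block_points_def block_duration_def)

lemma core_level_Suc: "core_level \<beta> (Suc m) = core_level \<beta> m + block_height (\<beta> (Suc m))"
  by (simp add: core_level_def)

lemma core_time_Suc: "core_time \<beta> (Suc m) = core_time \<beta> m + block_duration (\<beta> (Suc m))"
  by (simp add: core_time_def)

lemma core_path_Suc:
  "core_path \<beta> m = u @ [c] \<Longrightarrow> core_path \<beta> (Suc m) = u @ map ((+) c) (0 # block_points (\<beta> (Suc m)))"
  by simp

lemma valid_core_path:
  "valid_blocks \<beta> m \<Longrightarrow> passage_path m (core_level \<beta> m) (core_path \<beta> m) \<and>
     length (core_path \<beta> m) = Suc (core_time \<beta> m)"
proof (induction m)
  case 0
  then show ?case by (simp add: valid_blocks_0 initial_block_iff core_level_def core_time_def)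
next
  case (Suc m)
  then have v: "valid_blocks \<beta> m" "step_block (\<beta> (Suc m))" by (auto simp: valid_blocks_Suc)
  note IH = Suc.IH[OF v(1)]
  then obtain u c where uc: "core_path \<beta> m = u @ [c]" by (metis length_Suc_conv_rev)
  have "passage_path (Suc m) (core_level \<beta> m + block_height (\<beta> (Suc m)))
      (u @ map ((+) c) (0 # block_points (\<beta> (Suc m))))"
    using IH v(2) unfolding uc step_block_iff by (intro passage_path_concat(1)) auto
  then show ?case unfolding core_path_Suc[OF uc] core_level_Suc core_time_Suc
    using IH v(2) by (simp add: uc step_block_iff)
qed

lemma core_seq_eq_core_path:
  "valid_blocks \<beta> m \<Longrightarrow> t \<le> core_time \<beta> m \<Longrightarrow> core_seq \<beta> t = core_path \<beta> m ! t"
proof (induction m arbitrary: t)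
  case 0
  then show ?case by (simp add: core_seq_initial)
next
  case (Suc m)
  then have v: "valid_blocks \<beta> m" "step_block (\<beta> (Suc m))" by (auto simp: valid_blocks_Suc)
  have len: "length (core_path \<beta> m) = Suc (core_time \<beta> m)" using valid_core_path[OF v(1)] by simp
  show ?case
  proof (cases "t \<le> core_time \<beta> m")
    case True
    then show ?thesis using Suc.IH[OF v(1)] len by (simp add: nth_append)
  next
    case False
    define j where "j = t - core_time \<beta> m"
    have j: "t = core_time \<beta> m + j" "1 \<le> j" "j \<le> block_duration (\<beta> (Suc m))"
      using False Suc.prems(2) unfolding j_def core_time_Suc by auto
    have "core_seq \<beta> t = core_seq \<beta> (core_time \<beta> m) + block_points (\<beta> (Suc m)) ! (j - 1)"
      using core_seq_step[of "Suc m" j \<beta>] j by simp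
    also have "core_seq \<beta> (core_time \<beta> m) = last (core_path \<beta> m)"
      using Suc.IH[OF v(1), of "core_time \<beta> m"] len by (subst last_conv_nth) auto
    finally show ?thesis using j len v(2) by (simp add: nth_append step_block_iff)
  qed
qed

text \<open>The glued path is itself a first passage path to \<open>core_level\<close>, so the first
  passage time of the core sequence to this level is \<open>core_time\<close>. Blocks after m do not
  enter.\<close>

lemma core_seq_event_iff:
  assumes "valid_blocks \<beta> m"
  shows "alpha (core_seq \<beta>) (core_level \<beta> m) < \<infinity> \<and>
      initial_path (core_seq \<beta>) (alpha (core_seq \<beta>) (core_level \<beta> m)) = p \<longleftrightarrow> core_path \<beta> m = p"
proof -
  have p: "passage_path m (core_level \<beta> m) (core_path \<beta> m)"
    and len: "length (core_path \<beta> m) = Suc (core_time \<beta> m)"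
    using valid_core_path[OF assms] by auto
  have "map (core_seq \<beta>) [0..<Suc (core_time \<beta> m)] = core_path \<beta> m"
    using len core_seq_eq_core_path[OF assms] by (intro nth_equalityI) (auto simp del: upt_Suc)
  moreover from this have "alpha (core_seq \<beta>) (core_level \<beta> m) = enat (core_time \<beta> m)"
    using p by (simp add: alpha_eq_iff_first_passage passage_path_def del: upt_Suc)
  ultimately show ?thesis by (simp add: initial_path_def)
qed

lemma core_path_cong: "(\<And>i. i \<le> m \<Longrightarrow> \<beta> i = \<beta>' i) \<Longrightarrow> core_path \<beta> m = core_path \<beta>' m"
  by (induction m) auto

lemma core_level_cong: "(\<And>i. i \<le> m \<Longrightarrow> \<beta> i = \<beta>' i) \<Longrightarrow> core_level \<beta> m = core_level \<beta>' m"
  by (simp add: core_level_def)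

lemma valid_blocks_cong: "(\<And>i. i \<le> m \<Longrightarrow> \<beta> i = \<beta>' i) \<Longrightarrow> valid_blocks \<beta> m = valid_blocks \<beta>' m"
  by (simp add: valid_blocks_def)

text \<open>Surjectivity of the gluing: the part above the last cut becomes block m, and the part
  below is treated by induction. Entries beyond m are arbitrary.\<close>

lemma ex_valid_blocks:
  "passage_path m n p \<Longrightarrow> \<exists>\<beta>. valid_blocks \<beta> m \<and> core_level \<beta> m = n \<and> core_path \<beta> m = p"
proof (induction m arbitrary: n p)
  case 0
  then have "p \<noteq> []" by (auto simp: passage_path_def first_passage_def)
  with 0 show ?case
    by (intro exI[of _ "\<lambda>_. (n, length p - 1, p)"])
       (auto simp: valid_blocks_0 initial_block_iff core_level_def block_height_def block_points_def block_duration_def)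
next
  case (Suc m)
  obtain u c xs k l where s: "p = u @ map ((+) c) (0 # xs)" "passage_path m k (u @ [c])"
    "block_path l xs" "n = k + l" using passage_path_split[OF Suc.prems] .
  from Suc.IH[OF s(2)] obtain \<beta> where \<beta>: "valid_blocks \<beta> m" "core_level \<beta> m = k" "core_path \<beta> m = u @ [c]"
    by blast
  define \<beta>' where "\<beta>' = \<beta>(Suc m := (l, length xs, xs))"
  have eq: "\<beta>' i = \<beta> i" if "i \<le> m" for i using that by (simp add: \<beta>'_def)
  have new: "block_height (\<beta>' (Suc m)) = l" "block_duration (\<beta>' (Suc m)) = length xs"
      "block_points (\<beta>' (Suc m)) = xs"
    by (simp_all add: \<beta>'_def block_height_def block_points_def block_duration_def)
  have "valid_blocks \<beta>' m" "core_level \<beta>' m = k" "core_path \<beta>' m = u @ [c]"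
    using \<beta> eq valid_blocks_cong[of m \<beta>' \<beta>] core_level_cong[of m \<beta>' \<beta>] core_path_cong[of m \<beta>' \<beta>] by auto
  then show ?case using s new
    by (intro exI[of _ \<beta>']) (simp add: valid_blocks_Suc step_block_iff core_level_Suc)
qed

text \<open>Injectivity of the gluing: the last block is recovered by \<open>concat_unique\<close>,
  which also returns equal shorter paths and levels. Durations agree because validity ties them to
  the lists.\<close>

lemma valid_blocks_unique:
  assumes "valid_blocks \<beta> m" "valid_blocks \<beta>' m" "core_level \<beta> m = core_level \<beta>' m"
    and "core_path \<beta> m = core_path \<beta>' m" "i \<le> m"
  shows "\<beta> i = \<beta>' i"
  using assms
proof (induction m arbitrary: i)
  case 0
  then show ?case
    by (intro block_eqI) (auto simp: valid_blocks_0 initial_block_iff core_level_def)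
next
  case (Suc m)
  have v: "valid_blocks \<beta> m" "step_block (\<beta> (Suc m))" "valid_blocks \<beta>' m" "step_block (\<beta>' (Suc m))"
    using Suc.prems by (auto simp: valid_blocks_Suc)
  note p = valid_core_path[OF v(1)] valid_core_path[OF v(3)]
  obtain u c where uc: "core_path \<beta> m = u @ [c]" using p by (metis length_Suc_conv_rev)
  obtain u' c' where uc': "core_path \<beta>' m = u' @ [c']" using p by (metis length_Suc_conv_rev)
  have "passage_path m (core_level \<beta> m) (u @ [c])" "passage_path m (core_level \<beta>' m) (u' @ [c'])"
    using p uc uc' by auto
  moreover have "block_path (block_height (\<beta> (Suc m))) (block_points (\<beta> (Suc m)))"
    "block_path (block_height (\<beta>' (Suc m))) (block_points (\<beta>' (Suc m)))"
    using v by (auto simp: step_block_iff)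
  moreover have "u @ map ((+) c) (0 # block_points (\<beta> (Suc m))) = u' @ map ((+) c') (0 # block_points (\<beta>' (Suc m)))"
    using Suc.prems(4) unfolding core_path_Suc[OF uc] core_path_Suc[OF uc'] .
  moreover have "core_level \<beta> m + block_height (\<beta> (Suc m)) = core_level \<beta>' m + block_height (\<beta>' (Suc m))"
    using Suc.prems(3) unfolding core_level_Suc .
  ultimately have eqs: "u = u'" "c = c'" "block_points (\<beta> (Suc m)) = block_points (\<beta>' (Suc m))"
    "core_level \<beta> m = core_level \<beta>' m" "block_height (\<beta> (Suc m)) = block_height (\<beta>' (Suc m))"
    using concat_unique by metis+
  show ?case
  proof (cases "i = Suc m")
    case True
    then show ?thesis using eqs v by (auto intro!: block_eqI simp: step_block_iff)
  next
    case False
    then show ?thesis using Suc.IH[of i] Suc.prems(5) v eqs uc uc' by simp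
  qed
qed

lemma (in constrained_walk) path_weight_core_path:
  "valid_blocks \<beta> m \<Longrightarrow> path_weight (core_path \<beta> m) =
     path_weight (block_points (\<beta> 0)) * (\<Prod>i=1..m. block_weight (block_points (\<beta> i)))"
proof (induction m)
  case (Suc m)
  then have v: "valid_blocks \<beta> m" "step_block (\<beta> (Suc m))" by (auto simp: valid_blocks_Suc)
  note p = valid_core_path[OF v(1)]
  then obtain u c where uc: "core_path \<beta> m = u @ [c]" by (metis length_Suc_conv_rev)
  have "path_weight (core_path \<beta> (Suc m)) = path_weight (core_path \<beta> m) * block_weight (block_points (\<beta> (Suc m)))"
    unfolding core_path_Suc[OF uc] uc
    using p v(2) unfolding uc step_block_iff by (intro path_weight_concat) auto
  then show ?case using Suc.IH[OF v(1)] by simp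
qed simp

section \<open>Almost sure validity of the blocks\<close>

locale core_sequence = constrained_walk M S0 \<xi> H + core: prob_space N
  for M :: "'w measure"
    and S0 :: "'w \<Rightarrow> 'd::{finite, one} lattice"
    and \<xi> :: "nat \<Rightarrow> 'w \<Rightarrow> 'd lattice"
    and H :: "'d lattice \<Rightarrow> 'w \<Rightarrow> enat"
    and N :: "'v measure" +
  fixes q \<psi>0 :: real
    and b :: "nat \<Rightarrow> 'v \<Rightarrow> 'd block"
  assumes rate: "is_core_rate M \<xi> H q"
    and norm: "is_core_norm M S0 \<xi> H q \<psi>0"
    and blocks: "core_blocks M S0 \<xi> H q \<psi>0 N b"
begin

lemma q_pos: "0 < q"
  using rate by (simp add: is_core_rate_def)

lemma b_measurable [measurable]: "b i \<in> measurable N (count_space UNIV)"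
  using blocks unfolding core_blocks_def core.indep_vars_def by blast

lemma block_event [measurable]: "{v\<in>space N. R (b i v)} \<in> sets N"
  using measurable_sets[OF b_measurable, of "Collect R" i] by (simp add: vimage_def Int_def conj_commute)

lemma prob_initial_block:
  assumes "initial_block (k, K, ys)"
  shows "\<P>(v in N. b 0 v = (k, K, ys)) = path_weight ys / (\<psi>0 * q ^ k)"
proof -
  have p: "passage_path 0 k ys" "length ys = K + 1" using assms by (auto simp: initial_block_def)
  then have "k < length ys" by (intro first_passage_le_length) (auto simp: passage_path_def)
  then have "k \<le> K" using p by simp
  with blocks p(2) have "\<P>(v in N. b 0 v = (k, K, ys)) =
        \<P>(\<omega> in M. alpha (walk S0 \<xi> \<omega>) k = enat K \<and>
                   enat K < death_time (walk S0 \<xi> \<omega>) (\<lambda>x. H x \<omega>) \<and>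
                   eta (walk S0 \<xi> \<omega>) (\<lambda>x. H x \<omega>) k = 0 \<and>
                   map (walk S0 \<xi> \<omega>) [0..<K + 1] = ys) / (\<psi>0 * q ^ k)"
    unfolding core_blocks_def by blast
  then show ?thesis unfolding eta_block_iff[OF p(2)] prob_eta_path using p(1) by simp
qed

lemma prob_step_block:
  assumes "step_block (l, L, xs)" "1 \<le> i"
  shows "\<P>(v in N. b i v = (l, L, xs)) = block_weight xs / q ^ l"
proof -
  have p: "block_path l xs" "length xs = L" using assms by (auto simp: step_block_def)
  then have l: "1 \<le> l" by (simp add: block_path_def)
  have "l < length (0 # xs)" using p(1) by (intro first_passage_le_length) (auto simp: block_path_def)
  then have "l \<le> L" using p by simp
  with blocks p(2) l assms(2) have "\<P>(v in N. b i v = (l, L, xs)) =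
        \<P>(\<omega> in M. alpha (walk (\<lambda>_. 0) \<xi> \<omega>) l = enat L \<and>
                   enat L < death_time (walk (\<lambda>_. 0) \<xi> \<omega>) (half_constraint H \<omega>) \<and>
                   kappa (walk (\<lambda>_. 0) \<xi> \<omega>) (half_constraint H \<omega>) l = 0 \<and>
                   map (\<lambda>t. walk (\<lambda>_. 0) \<xi> \<omega> t - walk (\<lambda>_. 0) \<xi> \<omega> 0) [1..<L + 1] = xs) / q ^ l"
    unfolding core_blocks_def by blast
  then show ?thesis
    by (subst (asm) kappa_block_iff) (simp_all add: walk_0 p prob_kappa_path[OF l, simplified])
qed

text \<open>The term for m = 0 is P_*(B_0), which is positive by (A2): almost surely, survival up to
  alpha(0) leaves 0 as the only separating level. All other terms are non-negative.\<close>

lemma psi_pos: "0 < \<psi>0"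
proof -
  let ?f = "\<lambda>m. \<P>(\<omega> in M. eta (walk S0 \<xi> \<omega>) (\<lambda>x. H x \<omega>) m = 0)"
  have "\<P>(\<omega> in M. alpha (walk S0 \<xi> \<omega>) 0 < death_time (walk S0 \<xi> \<omega>) (\<lambda>x. H x \<omega>) \<and>
        initial_path (walk S0 \<xi> \<omega>) (alpha (walk S0 \<xi> \<omega>) 0) \<in> UNIV) =
    1 * \<P>(\<omega> in M. (alpha (walk S0 \<xi> \<omega>) 0 < death_time (walk S0 \<xi> \<omega>) (\<lambda>x. H x \<omega>) \<and>
        eta (walk S0 \<xi> \<omega>) (\<lambda>x. H x \<omega>) 0 = int 0) \<and>
        initial_path (walk S0 \<xi> \<omega>) (alpha (walk S0 \<xi> \<omega>) 0) \<in> UNIV)"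
  proof (rule prob_countable_transfer)
    show "{\<omega> \<in> space M. alpha (walk S0 \<xi> \<omega>) 0 < death_time (walk S0 \<xi> \<omega>) (\<lambda>x. H x \<omega>) \<and>
        initial_path (walk S0 \<xi> \<omega>) (alpha (walk S0 \<xi> \<omega>) 0) = p} \<in> events" for p
      by (rule survives_path_measurable)
    show "{\<omega> \<in> space M. (alpha (walk S0 \<xi> \<omega>) 0 < death_time (walk S0 \<xi> \<omega>) (\<lambda>x. H x \<omega>) \<and>
        eta (walk S0 \<xi> \<omega>) (\<lambda>x. H x \<omega>) 0 = int 0) \<and>
        initial_path (walk S0 \<xi> \<omega>) (alpha (walk S0 \<xi> \<omega>) 0) = p} \<in> events" for p
      unfolding conj_assoc by (rule eta_path_measurable)
    fix p
    have "\<P>(\<omega> in M. alpha (walk S0 \<xi> \<omega>) 0 < death_time (walk S0 \<xi> \<omega>) (\<lambda>x. H x \<omega>) \<and>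
        initial_path (walk S0 \<xi> \<omega>) (alpha (walk S0 \<xi> \<omega>) 0) = p) =
        (if first_passage 0 p then path_weight p else 0)"
    proof (cases "first_passage 0 p")
      case True
      moreover from this have "p \<noteq> []" by (simp add: first_passage_def)
      ultimately show ?thesis unfolding survives_event_iff using prob_walk_path[of p] by simp
    qed (unfold survives_event_iff, simp)
    \<comment> \<open>A skip-free path stopped on first reaching level 0 has 0 as its only level,
      and every other path in question has weight 0.\<close>
    also have "\<dots> = (if passage_path 0 0 p then path_weight p else 0)"
    proof (cases "first_passage 0 p \<and> skip_free p")
      case True
      then have "levels p = {0}" using passage_pathD[of p 0] by auto
      with True show ?thesis by (simp add: passage_path_def)
    next
      case False
      then show ?thesis using path_weight_nonzero[of p] by (auto simp: passage_path_def first_passage_def)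
    qed
    finally show "\<P>(\<omega> in M. alpha (walk S0 \<xi> \<omega>) 0 < death_time (walk S0 \<xi> \<omega>) (\<lambda>x. H x \<omega>) \<and>
        initial_path (walk S0 \<xi> \<omega>) (alpha (walk S0 \<xi> \<omega>) 0) = p) =
      1 * \<P>(\<omega> in M. (alpha (walk S0 \<xi> \<omega>) 0 < death_time (walk S0 \<xi> \<omega>) (\<lambda>x. H x \<omega>) \<and>
        eta (walk S0 \<xi> \<omega>) (\<lambda>x. H x \<omega>) 0 = int 0) \<and>
        initial_path (walk S0 \<xi> \<omega>) (alpha (walk S0 \<xi> \<omega>) 0) = p)"
      unfolding conj_assoc prob_eta_path by simp
  qed (simp_all add: prob_space_axioms)
  then have "?f 0 = \<P>(\<omega> in M. survives_to (walk S0 \<xi> \<omega>) (\<lambda>x. H x \<omega>) 0)"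
    unfolding survives_to_def by (subst eta_eq_0_iff) simp
  then have pos: "0 < ?f 0 / q ^ 0" using A2_pos by simp
  have sums: "(\<lambda>m. ?f m / q ^ m) sums \<psi>0" using norm by (simp add: is_core_norm_def)
  have "0 < (\<Sum>m. ?f m / q ^ m)"
    using q_pos by (intro suminf_pos2[where i = 0] sums_summable[OF sums] pos) simp
  then show ?thesis by (simp only: sums_unique[OF sums, symmetric])
qed

text \<open>Summing the prescribed weights over all paths of a given height k yields P_*(eta(k) = 0)
  / (psi0 q^k). The sum over k is psi0 / psi0 = 1, so nothing is left for other triples.\<close>

lemma AE_initial_block: "AE v in N. initial_block (b 0 v)"
proof -
  let ?f = "\<lambda>m. \<P>(\<omega> in M. eta (walk S0 \<xi> \<omega>) (\<lambda>x. H x \<omega>) m = 0)"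
  have height: "\<P>(v in N. initial_block (b 0 v) \<and> block_height (b 0 v) = k) = ?f k / q ^ k / \<psi>0" for k
  proof -
    have "\<P>(v in N. (initial_block (b 0 v) \<and> block_height (b 0 v) = k) \<and> block_points (b 0 v) \<in> UNIV) =
      1 / (\<psi>0 * q ^ k) * \<P>(\<omega> in M. (alpha (walk S0 \<xi> \<omega>) k < death_time (walk S0 \<xi> \<omega>) (\<lambda>x. H x \<omega>) \<and>
        eta (walk S0 \<xi> \<omega>) (\<lambda>x. H x \<omega>) k = int 0) \<and>
        initial_path (walk S0 \<xi> \<omega>) (alpha (walk S0 \<xi> \<omega>) k) \<in> UNIV)"
    proof (rule prob_countable_transfer)
      show "{v \<in> space N. (initial_block (b 0 v) \<and> block_height (b 0 v) = k) \<and> block_points (b 0 v) = ys} \<in> core.events" for ys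
        by (rule block_event)
      show "{\<omega> \<in> space M. (alpha (walk S0 \<xi> \<omega>) k < death_time (walk S0 \<xi> \<omega>) (\<lambda>x. H x \<omega>) \<and>
        eta (walk S0 \<xi> \<omega>) (\<lambda>x. H x \<omega>) k = int 0) \<and>
        initial_path (walk S0 \<xi> \<omega>) (alpha (walk S0 \<xi> \<omega>) k) = ys} \<in> events" for ys
        unfolding conj_assoc by (rule eta_path_measurable)
      fix ys
      have *: "(initial_block c \<and> block_height c = k) \<and> block_points c = ys \<longleftrightarrow>
          passage_path 0 k ys \<and> c = (k, length ys - 1, ys)" for c :: "'d block"
        by (cases c) (auto simp: initial_block_def block_height_def block_points_def passage_path_def first_passage_def)
      have "\<P>(v in N. (initial_block (b 0 v) \<and> block_height (b 0 v) = k) \<and> block_points (b 0 v) = ys) =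
         (if passage_path 0 k ys then path_weight ys / (\<psi>0 * q ^ k) else 0)"
      proof (cases "passage_path 0 k ys")
        case True
        then have "initial_block (k, length ys - 1, ys)" 
          by (auto simp: initial_block_def passage_path_def first_passage_def)
        then show ?thesis unfolding * using True prob_initial_block[of k "length ys - 1" ys] by simp
      qed (unfold *, simp)
      then show "\<P>(v in N. (initial_block (b 0 v) \<and> block_height (b 0 v) = k) \<and> block_points (b 0 v) = ys) =
        1 / (\<psi>0 * q ^ k) * \<P>(\<omega> in M. (alpha (walk S0 \<xi> \<omega>) k < death_time (walk S0 \<xi> \<omega>) (\<lambda>x. H x \<omega>) \<and>
        eta (walk S0 \<xi> \<omega>) (\<lambda>x. H x \<omega>) k = int 0) \<and>
        initial_path (walk S0 \<xi> \<omega>) (alpha (walk S0 \<xi> \<omega>) k) = ys)"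
        unfolding conj_assoc prob_eta_path by simp
    qed (use psi_pos q_pos in \<open>simp_all add: prob_space_axioms core.prob_space_axioms\<close>)
    then show ?thesis by (subst eta_eq_0_iff) (simp add: mult.commute)
  qed
  have "(\<lambda>k. \<P>(v in N. initial_block (b 0 v) \<and> block_height (b 0 v) = k)) sums
      measure N (\<Union>k. {v\<in>space N. initial_block (b 0 v) \<and> block_height (b 0 v) = k})"
    using block_event by (intro core.finite_measure_UNION) (auto simp: disjoint_family_on_def)
  also have "(\<Union>k. {v\<in>space N. initial_block (b 0 v) \<and> block_height (b 0 v) = k}) =
      {v\<in>space N. initial_block (b 0 v)}" by auto
  finally have "(\<lambda>k. ?f k / q ^ k / \<psi>0) sums \<P>(v in N. initial_block (b 0 v))" unfolding height .
  moreover have "(\<lambda>k. ?f k / q ^ k / \<psi>0) sums (\<psi>0 / \<psi>0)"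
    using norm unfolding is_core_norm_def by (rule sums_divide)
  ultimately have "\<P>(v in N. initial_block (b 0 v)) = \<psi>0 / \<psi>0" by (rule sums_unique2)
  then show ?thesis using psi_pos by (simp add: core.prob_Collect_eq_1[OF block_event])
qed

text \<open>The same count of mass as for the initial block, with the equation that defines q in
  place of the normalization by psi0.\<close>

lemma AE_step_block:
  assumes "1 \<le> i"
  shows "AE v in N. step_block (b i v)"
proof -
  let ?f = "\<lambda>m. \<P>(\<omega> in M. kappa (walk (\<lambda>_. 0) \<xi> \<omega>) (half_constraint H \<omega>) m = 0)"
  have height: "\<P>(v in N. step_block (b i v) \<and> block_height (b i v) = l) = ?f l / q ^ l" if l: "1 \<le> l" for l
  proof -
    \<comment> \<open>The origin is prepended so that displacement lists can be compared with
      initial paths of the walk from 0.\<close>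
    have "\<P>(v in N. (step_block (b i v) \<and> block_height (b i v) = l) \<and> 0 # block_points (b i v) \<in> UNIV) =
      1 / q ^ l * \<P>(\<omega> in M. (alpha (walk (\<lambda>_. 0) \<xi> \<omega>) l < \<infinity> \<and>
        kappa (walk (\<lambda>_. 0) \<xi> \<omega>) (half_constraint H \<omega>) l = 0) \<and>
        initial_path (walk (\<lambda>_. 0) \<xi> \<omega>) (alpha (walk (\<lambda>_. 0) \<xi> \<omega>) l) \<in> UNIV)"
    proof (rule prob_countable_transfer)
      show "{v \<in> space N. (step_block (b i v) \<and> block_height (b i v) = l) \<and> 0 # block_points (b i v) = p} \<in> core.events" for p
        by (rule block_event)
      show "{\<omega> \<in> space M. (alpha (walk (\<lambda>_. 0) \<xi> \<omega>) l < \<infinity> \<and>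
        kappa (walk (\<lambda>_. 0) \<xi> \<omega>) (half_constraint H \<omega>) l = 0) \<and>
        initial_path (walk (\<lambda>_. 0) \<xi> \<omega>) (alpha (walk (\<lambda>_. 0) \<xi> \<omega>) l) = p} \<in> events" for p
        unfolding conj_assoc by (rule kappa_path_measurable)
      fix p
      show "\<P>(v in N. (step_block (b i v) \<and> block_height (b i v) = l) \<and> 0 # block_points (b i v) = p) =
        1 / q ^ l * \<P>(\<omega> in M. (alpha (walk (\<lambda>_. 0) \<xi> \<omega>) l < \<infinity> \<and>
        kappa (walk (\<lambda>_. 0) \<xi> \<omega>) (half_constraint H \<omega>) l = 0) \<and>
        initial_path (walk (\<lambda>_. 0) \<xi> \<omega>) (alpha (walk (\<lambda>_. 0) \<xi> \<omega>) l) = p)"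
      proof (cases "\<exists>xs. p = 0 # xs")
        case True
        then obtain xs where p: "p = 0 # xs" by blast
        have *: "(step_block c \<and> block_height c = l) \<and> 0 # block_points c = 0 # xs \<longleftrightarrow>
            block_path l xs \<and> c = (l, length xs, xs)" for c :: "'d block"
          by (cases c) (auto simp: step_block_def block_height_def block_points_def)
        have "\<P>(v in N. (step_block (b i v) \<and> block_height (b i v) = l) \<and> 0 # block_points (b i v) = 0 # xs) =
          (if block_path l xs then block_weight xs / q ^ l else 0)"
        proof (cases "block_path l xs")
          case True
          then have "step_block (l, length xs, xs)" by (auto simp: step_block_def)
          then show ?thesis unfolding * using True prob_step_block[OF _ assms, of l "length xs" xs] by simp
        qed (unfold *, simp)
        then show ?thesis unfolding p conj_assoc prob_kappa_path[OF l] by simp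
      next
        case False
        \<comment> \<open>For a list that does not begin with the origin both events are
          empty.\<close>
        have "initial_path (walk (\<lambda>_. 0) \<xi> \<omega>) (alpha (walk (\<lambda>_. 0) \<xi> \<omega>) l) \<noteq> p" for \<omega>
          using False by (auto simp: initial_path_def walk_0 upt_conv_Cons simp del: upt_Suc)
        moreover have "0 # block_points (b i v) \<noteq> p" for v using False by auto
        ultimately show ?thesis by (simp only: simp_thms Collect_empty_eq measure_empty) simp
      qed
    qed (use q_pos in \<open>simp_all add: prob_space_axioms core.prob_space_axioms\<close>)
    then show ?thesis by (subst kappa_eq_0_iff_finite) simp
  qed
  \<comment> \<open>Heights of these blocks start at 1, which matches the series for q, indexed by
    \<open>Suc i\<close>.\<close>
  have height_Suc: "\<P>(v in N. step_block (b i v) \<and> block_height (b i v) = Suc k) = ?f (Suc k) / q ^ Suc k" for k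
    by (rule height) simp
  have pos: "\<exists>k. block_height c = Suc k" if "step_block c" for c :: "'d block"
    using that by (cases "block_height c") (auto simp: step_block_iff block_path_def)
  have "(\<lambda>k. \<P>(v in N. step_block (b i v) \<and> block_height (b i v) = Suc k)) sums
      measure N (\<Union>k. {v\<in>space N. step_block (b i v) \<and> block_height (b i v) = Suc k})"
    using block_event by (intro core.finite_measure_UNION) (auto simp: disjoint_family_on_def)
  also have "(\<Union>k. {v\<in>space N. step_block (b i v) \<and> block_height (b i v) = Suc k}) =
      {v\<in>space N. step_block (b i v)}"
    using pos by blast
  finally have "(\<lambda>k. ?f (Suc k) / q ^ Suc k) sums \<P>(v in N. step_block (b i v))" 
    by (simp only: height_Suc)
  moreover have "(\<lambda>k. ?f (Suc k) / q ^ Suc k) sums 1"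
    using rate unfolding is_core_rate_def by blast
  ultimately have "\<P>(v in N. step_block (b i v)) = 1" by (rule sums_unique2)
  then show ?thesis by (simp add: core.prob_Collect_eq_1[OF block_event])
qed

section \<open>The law of the glued path and the transfer to the core sequence\<close>

lemma AE_valid_blocks: "AE v in N. valid_blocks (\<lambda>i. b i v) m"
proof -
  have "AE v in N. \<forall>i\<in>{1..m}. step_block (b i v)" by (intro AE_finite_allI AE_step_block) auto
  with AE_initial_block show ?thesis unfolding valid_blocks_def by eventually_elim blast
qed

text \<open>By injectivity, a prescribed glued path and level fix each of the blocks 0, ..., m. The
  event becomes a rectangle, to which the independence of the blocks applies directly.\<close>

lemma core_path_event:
  assumes "valid_blocks \<beta> m" "core_level \<beta> m = n" "core_path \<beta> m = p"
  shows "{v\<in>space N. valid_blocks (\<lambda>i. b i v) m \<and> core_level (\<lambda>i. b i v) m = n \<and> core_path (\<lambda>i. b i v) m = p}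
    = (\<Inter>i\<in>{..m}. b i -` {\<beta> i} \<inter> space N)"
proof (intro set_eqI iffI)
  fix v assume "v \<in> {v\<in>space N. valid_blocks (\<lambda>i. b i v) m \<and> core_level (\<lambda>i. b i v) m = n \<and> core_path (\<lambda>i. b i v) m = p}"
  then show "v \<in> (\<Inter>i\<in>{..m}. b i -` {\<beta> i} \<inter> space N)"
    using valid_blocks_unique[of "\<lambda>i. b i v" m \<beta>] assms by auto
next
  fix v assume "v \<in> (\<Inter>i\<in>{..m}. b i -` {\<beta> i} \<inter> space N)"
  then have "v \<in> space N" "b i v = \<beta> i" if "i \<le> m" for i using that by auto
  then show "v \<in> {v\<in>space N. valid_blocks (\<lambda>i. b i v) m \<and> core_level (\<lambda>i. b i v) m = n \<and> core_path (\<lambda>i. b i v) m = p}"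
    using assms valid_blocks_cong[of m "\<lambda>i. b i v" \<beta>] core_level_cong[of m "\<lambda>i. b i v" \<beta>]
      core_path_cong[of m "\<lambda>i. b i v" \<beta>] by auto
qed

lemma prob_core_path:
  "\<P>(v in N. valid_blocks (\<lambda>i. b i v) m \<and> core_level (\<lambda>i. b i v) m = n \<and> core_path (\<lambda>i. b i v) m = p) =
    (if passage_path m n p then path_weight p / (\<psi>0 * q ^ n) else 0)" (is "measure N ?E = _")
  and core_path_event_measurable:
  "{v\<in>space N. valid_blocks (\<lambda>i. b i v) m \<and> core_level (\<lambda>i. b i v) m = n \<and> core_path (\<lambda>i. b i v) m = p} \<in> sets N"
proof -
  have "measure N ?E = (if passage_path m n p then path_weight p / (\<psi>0 * q ^ n) else 0) \<and> ?E \<in> sets N"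
  proof (cases "passage_path m n p")
    case True
    then obtain \<beta> where \<beta>: "valid_blocks \<beta> m" "core_level \<beta> m = n" "core_path \<beta> m = p"
      using ex_valid_blocks by blast
    note E = core_path_event[OF \<beta>]
    have indep: "core.indep_vars (\<lambda>_. count_space UNIV) b UNIV" using blocks by (simp add: core_blocks_def)
    have vs: "b i -` {\<beta> i} \<inter> space N = {v\<in>space N. b i v = \<beta> i}" for i by auto
    have "measure N ?E = (\<Prod>i\<in>{..m}. \<P>(v in N. b i v = \<beta> i))"
      unfolding E vs[symmetric] by (intro core.indep_varsD[OF indep]) auto
    also have "{..m} = insert 0 {1..m}" by auto
    also have "(\<Prod>i\<in>insert 0 {1..m}. \<P>(v in N. b i v = \<beta> i)) =
        \<P>(v in N. b 0 v = \<beta> 0) * (\<Prod>i=1..m. \<P>(v in N. b i v = \<beta> i))" by simp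
    also have "\<P>(v in N. b 0 v = \<beta> 0) = path_weight (block_points (\<beta> 0)) / (\<psi>0 * q ^ block_height (\<beta> 0))"
      using prob_initial_block[of "block_height (\<beta> 0)" "block_duration (\<beta> 0)" "block_points (\<beta> 0)"] \<beta>(1)
      by (simp add: valid_blocks_def block_height_def block_duration_def block_points_def)
    also have "(\<Prod>i=1..m. \<P>(v in N. b i v = \<beta> i)) =
        (\<Prod>i=1..m. block_weight (block_points (\<beta> i)) / q ^ block_height (\<beta> i))"
    proof (rule prod.cong)
      fix i assume "i \<in> {1..m}"
      then show "\<P>(v in N. b i v = \<beta> i) = block_weight (block_points (\<beta> i)) / q ^ block_height (\<beta> i)"
        using prob_step_block[of "block_height (\<beta> i)" "block_duration (\<beta> i)" "block_points (\<beta> i)" i] \<beta>(1)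
        by (simp add: valid_blocks_def block_height_def block_duration_def block_points_def)
    qed simp
    also have "\<dots> = (\<Prod>i=1..m. block_weight (block_points (\<beta> i))) / q ^ (\<Sum>i=1..m. block_height (\<beta> i))"
      by (simp add: prod_dividef power_sum)
    also have "path_weight (block_points (\<beta> 0)) / (\<psi>0 * q ^ block_height (\<beta> 0)) * \<dots> =
      path_weight p / (\<psi>0 * q ^ (block_height (\<beta> 0) + (\<Sum>i=1..m. block_height (\<beta> i))))"
      unfolding path_weight_core_path[OF \<beta>(1), unfolded \<beta>(3)] by (simp add: power_add)
    also have "block_height (\<beta> 0) + (\<Sum>i=1..m. block_height (\<beta> i)) = n"
    proof -
      have "{..m} = insert 0 {1..m}" by auto
      then show ?thesis using \<beta>(2) by (simp add: core_level_def)
    qed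
    finally have "measure N ?E = path_weight p / (\<psi>0 * q ^ n)" .
    moreover have "?E \<in> sets N" unfolding E vs by (intro sets.finite_INT block_event) auto
    ultimately show ?thesis using True by simp
  next
    case False
    \<comment> \<open>Valid blocks always glue to a passage path with m + 1 levels that ends at
      their total height.\<close>
    then have "?E = {}" using valid_core_path by blast
    with False show ?thesis by (simp only: measure_empty if_False sets.empty_sets simp_thms)
  qed
  then show "measure N ?E = (if passage_path m n p then path_weight p / (\<psi>0 * q ^ n) else 0)" "?E \<in> sets N" by auto
qed

lemma core_time_measurable [measurable]: "(\<lambda>v. core_time (\<lambda>i. b i v) m) \<in> measurable N (count_space UNIV)"
  unfolding core_time_def
  by (intro measurable_sum_nat measurable_compose[OF b_measurable]) simp

text \<open>The recursion calls the sequence at a random earlier time and with a random block index.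
  Both take countably many values, so it suffices to have measurability for each fixed time and
  index and then to compose.\<close>

lemma core_seq_measurable [measurable]:
  "(\<lambda>v. core_seq (\<lambda>i. b i v) t) \<in> measurable N (count_space UNIV)"
proof (induction t rule: less_induct)
  case (less t)
  \<comment> \<open>The cutoff makes \<open>g s\<close> measurable for every s, whereas the
    induction hypothesis covers only s < t; composition with a random s requires all values.\<close>
  define g where "g s v = (if s < t then core_seq (\<lambda>i. b i v) s else 0)" for s v
  have g [measurable]: "g s \<in> measurable N (count_space UNIV)" for s
    unfolding g_def using less by (cases "s < t") auto
  define f where "f i v = g (core_time (\<lambda>i. b i v) (i - 1)) v +
    block_points (b i v) ! (t - core_time (\<lambda>i. b i v) (i - 1) - 1)" for i v
  have [measurable]: "(\<lambda>v. block_points (b i v) ! s) \<in> measurable N (count_space UNIV)" for i s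
    by (rule measurable_compose[OF b_measurable]) simp
  have 1: "(\<lambda>v. g s v + block_points (b i v) ! (t - s - 1)) \<in> measurable N (count_space UNIV)" for s i
    by measurable
  have f [measurable]: "f i \<in> measurable N (count_space UNIV)" for i
    unfolding f_def by (rule measurable_compose_countable[OF 1]) simp
  have 2: "(\<lambda>v. LEAST i. t \<le> core_time (\<lambda>i. b i v) i) \<in> measurable N (count_space UNIV)"
    by measurable
  have 3: "(\<lambda>v. f (LEAST i. t \<le> core_time (\<lambda>i. b i v) i) v) \<in> measurable N (count_space UNIV)"
    by (rule measurable_compose_countable[OF f 2])
  have "core_seq (\<lambda>i. b i v) t = (if t \<le> core_time (\<lambda>i. b i v) 0 then block_points (b 0 v) ! t
      else if \<exists>i. t \<le> core_time (\<lambda>i. b i v) i then f (LEAST i. t \<le> core_time (\<lambda>i. b i v) i) v else 0)" for v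
    using core_time_pred_Least[of t "\<lambda>i. b i v"]
    by (subst core_seq.simps) (simp add: f_def g_def Let_def)
  then show ?case using 3 by simp
qed

lemma prob_eta_eq_core:
  "\<P>(\<omega> in M. alpha (walk S0 \<xi> \<omega>) n < death_time (walk S0 \<xi> \<omega>) (\<lambda>x. H x \<omega>) \<and>
      eta (walk S0 \<xi> \<omega>) (\<lambda>x. H x \<omega>) n = int m \<and>
      initial_path (walk S0 \<xi> \<omega>) (alpha (walk S0 \<xi> \<omega>) n) \<in> A) =
   \<psi>0 * q ^ n * \<P>(v in N. core_level (\<lambda>i. b i v) m = n \<and> alpha (core_seq (\<lambda>i. b i v)) n < \<infinity> \<and>
      initial_path (core_seq (\<lambda>i. b i v)) (alpha (core_seq (\<lambda>i. b i v)) n) \<in> A)"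
proof -
  \<comment> \<open>The space N need not be complete, so almost sure agreement with a measurable
    event would not give measurability.\<close>
  have core_event: "{v\<in>space N. core_level (\<lambda>i. b i v) m = n \<and> alpha (core_seq (\<lambda>i. b i v)) n < \<infinity> \<and>
      initial_path (core_seq (\<lambda>i. b i v)) (alpha (core_seq (\<lambda>i. b i v)) n) = p} \<in> sets N" for p
  proof -
    have [measurable]: "(\<lambda>v. core_level (\<lambda>i. b i v) m) \<in> measurable N (count_space UNIV)"
      unfolding core_level_def by (intro measurable_sum_nat measurable_compose[OF b_measurable]) simp
    have "{v\<in>space N. core_level (\<lambda>i. b i v) m = n} \<in> sets N" by measurable
    then show ?thesis unfolding alpha_initial_path_iff
      by (intro sets.sets_Collect_conj sets.sets_Collect_const map_eq_in_sets core_seq_measurable)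
  qed
  have "\<P>(\<omega> in M. (alpha (walk S0 \<xi> \<omega>) n < death_time (walk S0 \<xi> \<omega>) (\<lambda>x. H x \<omega>) \<and>
      eta (walk S0 \<xi> \<omega>) (\<lambda>x. H x \<omega>) n = int m) \<and>
      initial_path (walk S0 \<xi> \<omega>) (alpha (walk S0 \<xi> \<omega>) n) \<in> A) =
   \<psi>0 * q ^ n * \<P>(v in N. (core_level (\<lambda>i. b i v) m = n \<and> alpha (core_seq (\<lambda>i. b i v)) n < \<infinity>) \<and>
      initial_path (core_seq (\<lambda>i. b i v)) (alpha (core_seq (\<lambda>i. b i v)) n) \<in> A)"
  proof (rule prob_countable_transfer)
    fix p
    \<comment> \<open>Where some block is invalid the core sequence need not be a glued path, so the
      equivalence can only hold almost surely.\<close>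
    have "AE v in N. (core_level (\<lambda>i. b i v) m = n \<and> alpha (core_seq (\<lambda>i. b i v)) n < \<infinity> \<and>
        initial_path (core_seq (\<lambda>i. b i v)) (alpha (core_seq (\<lambda>i. b i v)) n) = p) \<longleftrightarrow>
      (valid_blocks (\<lambda>i. b i v) m \<and> core_level (\<lambda>i. b i v) m = n \<and> core_path (\<lambda>i. b i v) m = p)"
      using AE_valid_blocks[of m]
    proof eventually_elim
      case (elim v)
      then show ?case using core_seq_event_iff[OF elim, of p] by auto
    qed
    then have "\<P>(v in N. core_level (\<lambda>i. b i v) m = n \<and> alpha (core_seq (\<lambda>i. b i v)) n < \<infinity> \<and>
        initial_path (core_seq (\<lambda>i. b i v)) (alpha (core_seq (\<lambda>i. b i v)) n) = p) =
      (if passage_path m n p then path_weight p / (\<psi>0 * q ^ n) else 0)"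
      unfolding prob_core_path[symmetric]
      by (intro core.finite_measure_eq_AE core_event core_path_event_measurable) (auto elim: eventually_mono)
    then show "\<P>(\<omega> in M. (alpha (walk S0 \<xi> \<omega>) n < death_time (walk S0 \<xi> \<omega>) (\<lambda>x. H x \<omega>) \<and>
      eta (walk S0 \<xi> \<omega>) (\<lambda>x. H x \<omega>) n = int m) \<and>
      initial_path (walk S0 \<xi> \<omega>) (alpha (walk S0 \<xi> \<omega>) n) = p) =
     \<psi>0 * q ^ n * \<P>(v in N. (core_level (\<lambda>i. b i v) m = n \<and> alpha (core_seq (\<lambda>i. b i v)) n < \<infinity>) \<and>
      initial_path (core_seq (\<lambda>i. b i v)) (alpha (core_seq (\<lambda>i. b i v)) n) = p)"
      unfolding conj_assoc prob_eta_path using psi_pos q_pos by simp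
    show "{v\<in>space N. (core_level (\<lambda>i. b i v) m = n \<and> alpha (core_seq (\<lambda>i. b i v)) n < \<infinity>) \<and>
      initial_path (core_seq (\<lambda>i. b i v)) (alpha (core_seq (\<lambda>i. b i v)) n) = p} \<in> sets N"
      unfolding conj_assoc by (rule core_event)
    show "{\<omega>\<in>space M. (alpha (walk S0 \<xi> \<omega>) n < death_time (walk S0 \<xi> \<omega>) (\<lambda>x. H x \<omega>) \<and>
      eta (walk S0 \<xi> \<omega>) (\<lambda>x. H x \<omega>) n = int m) \<and>
      initial_path (walk S0 \<xi> \<omega>) (alpha (walk S0 \<xi> \<omega>) n) = p} \<in> sets M"
      unfolding conj_assoc by (rule eta_path_measurable)
  qed (use psi_pos q_pos in \<open>simp_all add: prob_space_axioms core.prob_space_axioms\<close>)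
  then show ?thesis unfolding conj_assoc .
qed

end

theorem theorem2:
  fixes M :: "'w measure"
    and S0 :: "'w \<Rightarrow> 'd::{finite, one} lattice"
    and \<xi> :: "nat \<Rightarrow> 'w \<Rightarrow> 'd lattice"
    and H :: "'d lattice \<Rightarrow> 'w \<Rightarrow> enat"
    and q \<psi>0 :: real
    and N :: "'v measure"
    and b :: "nat \<Rightarrow> 'v \<Rightarrow> 'd block"
    and A :: "'d lattice list set"
    and n m :: nat
  assumes "constrained_walk M S0 \<xi> H"
    and "is_core_rate M \<xi> H q"
    and "is_core_norm M S0 \<xi> H q \<psi>0"
    and "prob_space N"
    and "core_blocks M S0 \<xi> H q \<psi>0 N b"
    and "A \<subseteq> {p. length p \<ge> 1}"
    and "m \<le> n"
  shows "\<P>(\<omega> in M. alpha (walk S0 \<xi> \<omega>) n < death_time (walk S0 \<xi> \<omega>) (\<lambda>x. H x \<omega>) \<and>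
                   eta (walk S0 \<xi> \<omega>) (\<lambda>x. H x \<omega>) n = int m \<and>
                   initial_path (walk S0 \<xi> \<omega>) (alpha (walk S0 \<xi> \<omega>) n) \<in> A) =
         \<psi>0 * q ^ n *
         \<P>(v in N. core_level (\<lambda>i. b i v) m = n \<and>
                   alpha (core_seq (\<lambda>i. b i v)) n < \<infinity> \<and>
                   initial_path (core_seq (\<lambda>i. b i v)) (alpha (core_seq (\<lambda>i. b i v)) n) \<in> A)"
proof -
  interpret core_sequence M S0 \<xi> H N q \<psi>0 b
    using assms by (intro core_sequence.intro core_sequence_axioms.intro)
  show ?thesis by (rule prob_eta_eq_core)
qed

end
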